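(* Every planar graph with girth at least $12$ is proper conflict-free $6$-choosable.
   Context: All graphs are simple and finite. The girth is the length of a shortest cycle (infinite for acyclic graphs). A proper conflict-free coloring of a graph $G$ is a proper vertex coloring $\phi$ such that for every non-isolated vertex $v$ some color appears exactly once on the open neighborhood $N(v)$. $G$ is proper conflict-free $k$-choosable if for every list assignment $L$ of $G$ with $|L(v)| = k$ for all $v\in V(G)$, there is a proper conflict-free coloring $\phi$ of $G$ with $\phi(v)\in L(v)$ for all $v\in V(G)$. *)

theory Defs
  imports
    "HOL-Analysis.Analysis"
    "HOL-Library.Extended_Nat"
    "Graph_Theory.Pair_Digraph"
begin

text \<open>
  A finite simple graph is a \<open>pair_graph\<close>: a finite digraph without loops whose set of arcs is
  symmetric, an undirected edge between \<open>u\<close> and \<open>v\<close> being the pair of arcs \<open>(u, v)\<close>, \<open>(v, u)\<close>.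
\<close>

definition neighborhood :: "'a pair_pre_digraph \<Rightarrow> 'a \<Rightarrow> 'a set" where
  "neighborhood G v = {u. (v, u) \<in> parcs G}"

text \<open>
  \<open>pre_digraph.cycle\<close> also accepts the closed walk \<open>u, v, u\<close> along a single undirected edge. In a
  \<open>pair_graph\<close> the cycles in the sense of undirected graphs are those with at least three arcs.
  The infimum of the empty set in \<open>enat\<close> is \<open>\<infinity>\<close>, the girth of an acyclic graph.
\<close>

definition girth :: "'a pair_pre_digraph \<Rightarrow> enat" where
  "girth G = (INF c \<in> {c. pre_digraph.cycle (with_proj G) c \<and> 3 \<le> length c}. enat (length c))"

text \<open>
  A drawing in the plane without crossings places the vertices at distinct points and represents
  each edge by a simple arc between its ends. An arc meets no further vertex, and two distinct
  arcs meet only in common ends. The arcs are indexed by the unordered edges \<open>{u, v}\<close>, so that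
  \<open>(u, v)\<close> and \<open>(v, u)\<close> share one curve.
\<close>

definition plane_drawing ::
    "'a pair_pre_digraph \<Rightarrow> ('a \<Rightarrow> complex) \<Rightarrow> ('a set \<Rightarrow> real \<Rightarrow> complex) \<Rightarrow> bool" where
  "plane_drawing G p \<gamma> \<longleftrightarrow>
     inj_on p (pverts G) \<and>
     (\<forall>(u, v) \<in> parcs G.
        arc (\<gamma> {u, v}) \<and>
        {pathstart (\<gamma> {u, v}), pathfinish (\<gamma> {u, v})} = {p u, p v} \<and>
        path_image (\<gamma> {u, v}) \<inter> p ` pverts G = {p u, p v}) \<and>
     (\<forall>(u, v) \<in> parcs G. \<forall>(x, y) \<in> parcs G.
        {u, v} \<noteq> {x, y} \<longrightarrow>
        path_image (\<gamma> {u, v}) \<inter> path_image (\<gamma> {x, y}) = p ` ({u, v} \<inter> {x, y}))"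

definition planar :: "'a pair_pre_digraph \<Rightarrow> bool" where
  "planar G \<longleftrightarrow> (\<exists>p \<gamma>. plane_drawing G p \<gamma>)"

definition proper_coloring :: "'a pair_pre_digraph \<Rightarrow> ('a \<Rightarrow> 'c) \<Rightarrow> bool" where
  "proper_coloring G \<phi> \<longleftrightarrow> (\<forall>(u, v) \<in> parcs G. \<phi> u \<noteq> \<phi> v)"

definition proper_conflict_free_coloring :: "'a pair_pre_digraph \<Rightarrow> ('a \<Rightarrow> 'c) \<Rightarrow> bool" where
  "proper_conflict_free_coloring G \<phi> \<longleftrightarrow>
     proper_coloring G \<phi> \<and>
     (\<forall>v \<in> pverts G. neighborhood G v \<noteq> {} \<longrightarrow>
        (\<exists>c. card {u \<in> neighborhood G v. \<phi> u = c} = 1))"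

text \<open>
  The colors are the elements of an arbitrary type \<open>'c\<close>. It does not occur in the type of the
  graph and is therefore passed explicitly, as \<open>TYPE('c)\<close>.
\<close>

definition proper_conflict_free_choosable ::
    "'c itself \<Rightarrow> nat \<Rightarrow> 'a pair_pre_digraph \<Rightarrow> bool" where
  "proper_conflict_free_choosable _ k G \<longleftrightarrow>
     (\<forall>L :: 'a \<Rightarrow> 'c set. (\<forall>v \<in> pverts G. finite (L v) \<and> card (L v) = k) \<longrightarrow>
        (\<exists>\<phi>. proper_conflict_free_coloring G \<phi> \<and> (\<forall>v \<in> pverts G. \<phi> v \<in> L v)))"

end

theory Submission
  imports Defs
begin

text \<open>
  A nonempty plane graph all of whose cycles have length at least 12 satisfies
  \<open>10 |E| + 12 \<le> 12 |V|\<close>. This bound is additive over the blocks, so let the graph have no cut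
  vertex. For a cycle \<open>C\<close> of length \<open>l\<close> with \<open>m\<close> edges and \<open>n\<close> vertices strictly inside,
  \<open>10 m + 12 \<le> 12 n + l\<close>: if \<open>m > 0\<close>, some path inside joins two vertices of \<open>C\<close> and splits \<open>C\<close>
  into two cycles, and adding their two inequalities gives the one for \<open>C\<close>. If \<open>m\<close> is maximal,
  nothing lies outside \<open>C\<close>, since a path outside together with one of the two arcs of \<open>C\<close> would
  form a cycle around the other arc.

  Hence every nonempty subgraph has average degree below 12/5, so by discharging it has a vertex of
  degree at most 1 or two adjacent vertices of degree 2. Delete these vertices and color the rest.
  A deleted vertex need only avoid the color of each remaining neighbour and one color that occurs
  exactly once around that neighbour; a deleted vertex of degree 2 moreover avoids the colors of the
  other deleted vertex and of that vertex's other neighbour. At most 4 colors are excluded.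
\<close>

section \<open>Theta curves in the plane\<close>

text \<open>Only the point set and the two ends are kept, so that an arc can be reversed or joined
  to another without tracking parametrisations.\<close>

definition arc_between :: "complex \<Rightarrow> complex \<Rightarrow> complex set \<Rightarrow> bool" where
  "arc_between a b S \<longleftrightarrow> (\<exists>g. arc g \<and> pathstart g = a \<and> pathfinish g = b \<and> path_image g = S)"

lemma arc_between_sym: "arc_between a b S \<Longrightarrow> arc_between b a S"
  unfolding arc_between_def
  by (metis arc_reversepath path_image_reversepath pathfinish_reversepath pathstart_reversepath)

lemma arc_between_connected:
  assumes "arc_between a b S"
  shows "connected S" "connected (S - {a, b})" "S - {a, b} \<noteq> {}"
proof -
  obtain g where g: "arc g" "pathstart g = a" "pathfinish g = b" "path_image g = S"
    using assms unfolding arc_between_def by blast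
  then have sp: "simple_path g" by (simp add: arc_imp_simple_path)
  show "connected S" using g connected_arc_image by blast
  show "connected (S - {a, b})" using connected_simple_path_endless[OF sp] g by simp
  show "S - {a, b} \<noteq> {}" using nonempty_simple_path_endless[OF sp] g by simp
qed

text \<open>An edge that leaves a cycle at \<open>b\<close> misses the cycle once \<open>b\<close>
  is removed. What remains must be connected to lie on a single side of the cycle.\<close>

lemma arc_between_connected_Diff_end:
  assumes "arc_between a b S"
  shows "connected (S - {b})"
proof -
  obtain g where g: "arc g" "pathstart g = a" "pathfinish g = b" "path_image g = S"
    using assms unfolding arc_between_def by blast
  have inj: "inj_on g {0..1}" and "path g" using g by (auto simp: arc_def)
  have "S - {b} = g ` ({0..1} - {1})"
    using g inj by (subst inj_on_image_set_diff[OF inj]) (auto simp: path_image_def pathfinish_def)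
  also have "{0..1} - {1::real} = {0..<1}" by auto
  finally have "S - {b} = g ` {0..<1}" .
  moreover have "continuous_on {0..<1} g"
    using \<open>path g\<close> by (auto simp: path_def intro: continuous_on_subset)
  ultimately show ?thesis by (metis connected_continuous_image connected_Ico)
qed

lemma arc_between_join:
  assumes "arc_between a b S" "arc_between b c T" "S \<inter> T \<subseteq> {b}"
  shows "arc_between a c (S \<union> T)"
proof -
  obtain g where g: "arc g" "pathstart g = a" "pathfinish g = b" "path_image g = S"
    using assms(1) unfolding arc_between_def by blast
  obtain h where h: "arc h" "pathstart h = b" "pathfinish h = c" "path_image h = T"
    using assms(2) unfolding arc_between_def by blast
  have "arc (g +++ h)" using g h assms(3) by (intro arc_join) auto
  then show ?thesis unfolding arc_between_def
    using g h by (intro exI[of _ "g +++ h"]) (auto simp: path_image_join)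
qed

text \<open>The first arc followed by the reversed second one is a simple closed curve, so the
  Jordan curve theorem applies.\<close>

lemma Jordan_arcs:
  assumes "arc_between a b S1" "arc_between a b S2" "S1 \<inter> S2 = {a, b}"
  shows "compact (S1 \<union> S2)" "connected (inside (S1 \<union> S2))" "connected (outside (S1 \<union> S2))"
    "inside (S1 \<union> S2) \<noteq> {}" "open (inside (S1 \<union> S2))" "open (outside (S1 \<union> S2))"
    "frontier (inside (S1 \<union> S2)) = S1 \<union> S2" "frontier (outside (S1 \<union> S2)) = S1 \<union> S2"
    "bounded (inside (S1 \<union> S2))" "\<not> bounded (outside (S1 \<union> S2))"
proof -
  obtain g where g: "arc g" "pathstart g = a" "pathfinish g = b" "path_image g = S1"
    using assms(1) unfolding arc_between_def by blast
  obtain h where h: "arc h" "pathstart h = b" "pathfinish h = a" "path_image h = S2"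
    using arc_between_sym[OF assms(2)] unfolding arc_between_def by blast
  have sp: "simple_path (g +++ h)" using g h assms(3) by (intro simple_path_join_loop) auto
  have im: "path_image (g +++ h) = S1 \<union> S2" using g h by (simp add: path_image_join)
  have loop: "pathfinish (g +++ h) = pathstart (g +++ h)" using g h by simp
  show "compact (S1 \<union> S2)" using compact_simple_path_image[OF sp] im by simp
  show "connected (inside (S1 \<union> S2))" "connected (outside (S1 \<union> S2))"
    "inside (S1 \<union> S2) \<noteq> {}" "open (inside (S1 \<union> S2))" "open (outside (S1 \<union> S2))"
    "frontier (inside (S1 \<union> S2)) = S1 \<union> S2" "frontier (outside (S1 \<union> S2)) = S1 \<union> S2"
    "bounded (inside (S1 \<union> S2))" "\<not> bounded (outside (S1 \<union> S2))"
    using Jordan_inside_outside[OF sp loop] unfolding im by auto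
qed

lemma connected_subset_inside:
  assumes "connected T" "T \<inter> S = {}" "T \<inter> inside S \<noteq> {}"
  shows "T \<subseteq> inside S"
  using inside_outside_intersect_connected[OF assms(1), of S] assms inside_Un_outside[of S] by blast

lemma connected_subset_outside:
  assumes "connected T" "T \<inter> S = {}" "T \<inter> outside S \<noteq> {}"
  shows "T \<subseteq> outside S"
  using inside_outside_intersect_connected[OF assms(1), of S] assms inside_Un_outside[of S] by blast

text \<open>The third arc is a chord of the disc bounded by the other two and cuts it in two. This
  transfers the library's splitting theorem for paths to arcs given as point sets.\<close>

lemma theta_inside:
  assumes "arc_between a b S1" "arc_between a b S2" "arc_between a b S"
    and "S1 \<inter> S2 = {a, b}" "S1 \<inter> S = {a, b}" "S2 \<inter> S = {a, b}"
    and "S \<inter> inside (S1 \<union> S2) \<noteq> {}"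
  shows "inside (S1 \<union> S) \<inter> inside (S2 \<union> S) = {}"
    and "inside (S1 \<union> S2) = inside (S1 \<union> S) \<union> inside (S2 \<union> S) \<union> (S - {a, b})"
proof -
  obtain c1 where c1: "arc c1" "pathstart c1 = a" "pathfinish c1 = b" "path_image c1 = S1"
    using assms(1) unfolding arc_between_def by blast
  obtain c2 where c2: "arc c2" "pathstart c2 = a" "pathfinish c2 = b" "path_image c2 = S2"
    using assms(2) unfolding arc_between_def by blast
  obtain c where c: "arc c" "pathstart c = a" "pathfinish c = b" "path_image c = S"
    using assms(3) unfolding arc_between_def by blast
  have "a \<noteq> b" using c arc_distinct_ends by blast
  have "inside (S1 \<union> S) \<inter> inside (S2 \<union> S) = {} \<and>
    inside (S1 \<union> S2) = inside (S1 \<union> S) \<union> inside (S2 \<union> S) \<union> (S - {a, b})"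
    by (rule split_inside_simple_closed_curve[of c1 a b c2 c])
       (use c1 c2 c assms(4-) \<open>a \<noteq> b\<close> in \<open>auto simp: arc_imp_simple_path\<close>)
  then show "inside (S1 \<union> S) \<inter> inside (S2 \<union> S) = {}"
    "inside (S1 \<union> S2) = inside (S1 \<union> S) \<union> inside (S2 \<union> S) \<union> (S - {a, b})" by auto
qed

text \<open>
  Otherwise each of the three arcs lies outside the curve formed by the other two, and the three
  interiors are disjoint. The closed discs bounded by \<open>S1 \<union> S2\<close> and by \<open>S1 \<union> S\<close> then meet in
  \<open>S1\<close> only, so by Janiszewski's theorem their union does not separate the plane, although it
  contains the curve \<open>S2 \<union> S\<close>.
\<close>

lemma theta_outside:
  assumes S1: "arc_between a b S1" and S2: "arc_between a b S2" and S: "arc_between a b S"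
    and S12: "S1 \<inter> S2 = {a, b}" and S1S: "S1 \<inter> S = {a, b}" and S2S: "S2 \<inter> S = {a, b}"
    and out: "S \<inter> outside (S1 \<union> S2) \<noteq> {}"
  shows "S2 \<inter> inside (S1 \<union> S) \<noteq> {} \<or> S1 \<inter> inside (S2 \<union> S) \<noteq> {}"
proof (rule ccontr)
  assume "\<not> ?thesis"
  then have n2: "S2 \<inter> inside (S1 \<union> S) = {}" and n1: "S1 \<inter> inside (S2 \<union> S) = {}" by auto
  note J12 = Jordan_arcs[OF S1 S2 S12]
  note J1 = Jordan_arcs[OF S1 S S1S]
  note J2 = Jordan_arcs[OF S2 S S2S]
  have "S - {a, b} \<subseteq> outside (S1 \<union> S2)"
  proof (rule connected_subset_outside)
    show "connected (S - {a, b})" using arc_between_connected[OF S] by blast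
    show "(S - {a, b}) \<inter> (S1 \<union> S2) = {}" using S1S S2S by auto
    have "{a, b} \<subseteq> S1 \<union> S2" using S12 by auto
    then show "(S - {a, b}) \<inter> outside (S1 \<union> S2) \<noteq> {}" using out outside_no_overlap[of "S1 \<union> S2"] by blast
  qed
  then have n: "S \<inter> inside (S1 \<union> S2) = {}"
    using inside_Int_outside[of "S1 \<union> S2"] inside_no_overlap[of "S1 \<union> S2"] S12 by blast
  \<comment> \<open>Every point of \<open>A\<close> is a limit of points of \<open>inside A\<close>.
    If one such point lies in the open set \<open>outside B\<close>, then \<open>inside A\<close>
    reaches into \<open>outside B\<close>; being connected and disjoint from \<open>B\<close>, it
    stays there, which is \<open>sub\<close>.\<close>
  have meet: "inside A \<inter> outside B \<noteq> {}"
    if "open (outside B)" "c \<in> outside B" "c \<in> A" "frontier (inside A) = A" for A B :: "complex set" and c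
  proof -
    have "c \<in> closure (inside A)" using that by (metis frontier_def DiffD1)
    then show ?thesis using that(1,2) by (meson closure_iff_nhds_not_empty order_refl disjoint_iff Int_commute)
  qed
  have sub: "inside A \<subseteq> outside B"
    if "open (outside B)" "c \<in> outside B" "c \<in> A" "frontier (inside A) = A" "connected (inside A)" "inside A \<inter> B = {}"
    for A B :: "complex set" and c
    using connected_subset_outside[OF that(5,6) meet[OF that(1-4)]] .
  obtain c2 where c2: "c2 \<in> S2" "c2 \<notin> {a, b}" using arc_between_connected(3)[OF S2] by blast
  obtain c1 where c1: "c1 \<in> S1" "c1 \<notin> {a, b}" using arc_between_connected(3)[OF S1] by blast
  \<comment> \<open>An interior point of \<open>S2\<close> lies neither on \<open>S1\<close> or
    \<open>S\<close> nor, by \<open>n2\<close>, inside their union. It is a point at which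
    \<open>sub\<close> can be applied; \<open>c1\<close> plays the same role for the other
    curve.\<close>
  have c2o: "c2 \<in> outside (S1 \<union> S)"
    using c2 n2 S12 S2S inside_Un_outside[of "S1 \<union> S"] by blast
  have c1o: "c1 \<in> outside (S2 \<union> S)"
    using c1 n1 S12 S1S inside_Un_outside[of "S2 \<union> S"] by blast
  have d12: "inside (S1 \<union> S2) \<inter> inside (S1 \<union> S) = {}"
  proof -
    have "inside (S1 \<union> S2) \<subseteq> outside (S1 \<union> S)"
      by (rule sub[OF J1(6) c2o _ J12(7) J12(2)]) (use c2 in simp, use n inside_no_overlap[of "S1 \<union> S2"] in blast)
    then show ?thesis using inside_Int_outside[of "S1 \<union> S"] by blast
  qed
  have d12': "inside (S1 \<union> S2) \<inter> inside (S2 \<union> S) = {}"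
  proof -
    have "inside (S1 \<union> S2) \<subseteq> outside (S2 \<union> S)"
      by (rule sub[OF J2(6) c1o _ J12(7) J12(2)]) (use c1 in simp, use n inside_no_overlap[of "S1 \<union> S2"] in blast)
    then show ?thesis using inside_Int_outside[of "S2 \<union> S"] by blast
  qed
  have d2: "inside (S1 \<union> S) \<inter> inside (S2 \<union> S) = {}"
  proof -
    have "inside (S1 \<union> S) \<subseteq> outside (S2 \<union> S)"
      by (rule sub[OF J2(6) c1o _ J1(7) J1(2)]) (use c1 in simp, use n2 inside_no_overlap[of "S1 \<union> S"] in blast)
    then show ?thesis using inside_Int_outside[of "S2 \<union> S"] by blast
  qed
  define D where "D = (S1 \<union> S2) \<union> inside (S1 \<union> S2)"
  define D' where "D' = (S1 \<union> S) \<union> inside (S1 \<union> S)"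
  have cD: "- D = outside (S1 \<union> S2)" and cD': "- D' = outside (S1 \<union> S)"
    unfolding D_def D'_def by (simp_all add: union_with_inside)
  have "bounded D" "bounded D'" unfolding D_def D'_def
    using compact_imp_bounded[OF J12(1)] compact_imp_bounded[OF J1(1)] J12(9) J1(9) by simp_all
  moreover have "closed D" "closed D'"
    using cD cD' J12(6) J1(6) by (auto simp: closed_def)
  ultimately have com: "compact D" "compact D'" by (auto simp: compact_eq_bounded_closed)
  have "D \<inter> D' = S1"
    using n n2 d12 S2S S12 S1S inside_no_overlap[of "S1 \<union> S2"] inside_no_overlap[of "S1 \<union> S"]
    unfolding D_def D'_def by blast
  then have "connected (D \<inter> D')" using arc_between_connected[OF S1] by simp
  moreover have "connected (- D)" "connected (- D')" using cD cD' J12(3) J1(3) by auto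
  ultimately have con: "connected (- (D \<union> D'))"
    using Janiszewski_connected com compact_imp_closed by blast
  have "S2 \<union> S \<subseteq> D \<union> D'" unfolding D_def D'_def by auto
  \<comment> \<open>The connected complement of the two discs contains the third interior and misses
    the curve around it, hence equals that interior and is bounded. Since the discs are bounded too,
    the whole plane would be bounded.\<close>
  have "inside (S2 \<union> S) \<subseteq> - (D \<union> D')"
    using n1 d2 d12' inside_no_overlap[of "S2 \<union> S"] unfolding D_def D'_def by blast
  then have "- (D \<union> D') \<subseteq> inside (S2 \<union> S)"
    using J2(4) \<open>S2 \<union> S \<subseteq> D \<union> D'\<close> by (intro connected_subset_inside[OF con]) auto
  then have "bounded (- (D \<union> D'))" using J2(9) bounded_subset by blast
  moreover have "bounded (D \<union> D')" using com compact_imp_bounded by auto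
  ultimately show False by (metis bounded_Un Un_commute Compl_partition not_bounded_UNIV)
qed

section \<open>Paths and cycles as vertex lists\<close>

fun edges_of :: "'a list \<Rightarrow> 'a set set" where
  "edges_of (u # v # xs) = insert {u, v} (edges_of (v # xs))"
| "edges_of _ = {}"

abbreviation rwalk :: "'a rel \<Rightarrow> 'a list \<Rightarrow> bool" where
  "rwalk A \<equiv> successively (\<lambda>u v. (u, v) \<in> A)"

text \<open>The list does not repeat its first vertex; appending \<open>hd xs\<close> closes the
  walk. Length 3 rules out running along one edge and back.\<close>

definition gcycle :: "'a rel \<Rightarrow> 'a list \<Rightarrow> bool" where
  "gcycle A xs \<longleftrightarrow> distinct xs \<and> 3 \<le> length xs \<and> rwalk A (xs @ [hd xs])"

definition cedges :: "'a list \<Rightarrow> 'a set set" where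
  "cedges xs = edges_of (xs @ [hd xs])"

lemma edges_of_append: "edges_of (xs @ y # zs) = edges_of (xs @ [y]) \<union> edges_of (y # zs)"
proof (induction xs)
  case (Cons x xs)
  then show ?case by (cases xs) auto
qed simp

lemma edges_of_rev: "edges_of (rev xs) = edges_of xs"
proof (induction xs rule: edges_of.induct)
  case (1 u v xs)
  have "edges_of (rev (u # v # xs)) = edges_of (rev xs @ v # [u])" by simp
  also have "\<dots> = edges_of (rev xs @ [v]) \<union> {{v, u}}" by (subst edges_of_append) simp
  finally show ?case using 1 by (simp add: insert_commute)
qed auto

lemma edges_of_subset: "e \<in> edges_of xs \<Longrightarrow> e \<subseteq> set xs"
  by (induction xs rule: edges_of.induct) auto

lemma finite_edges_of: "finite (edges_of xs)"
  by (induction xs rule: edges_of.induct) auto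

lemma card_edges_of: "card (edges_of xs) \<le> length xs - 1"
  by (induction xs rule: edges_of.induct)
     (auto intro: order_trans[OF card_insert_le_m1] simp: card_insert_if finite_edges_of)

lemma Union_edges_of: "2 \<le> length xs \<Longrightarrow> \<Union> (edges_of xs) = set xs"
proof (induction xs rule: edges_of.induct)
  case (1 u v xs)
  then show ?case by (cases xs) auto
qed auto

lemma edges_of_ends: "distinct (a # ys @ [b]) \<Longrightarrow> {a, b} \<in> edges_of (a # ys @ [b]) \<Longrightarrow> ys = []"
proof (cases ys)
  case (Cons y ys')
  assume d: "distinct (a # ys @ [b])" and e: "{a, b} \<in> edges_of (a # ys @ [b])"
  then have "{a, b} \<in> edges_of (y # ys' @ [b])" using Cons by (auto simp: doubleton_eq_iff)
  then show ?thesis using edges_of_subset[of "{a, b}"] d Cons by fastforce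
qed

lemma edges_of_rwalk: "rwalk A xs \<Longrightarrow> e \<in> edges_of xs \<Longrightarrow> \<exists>u v. (u, v) \<in> A \<and> e = {u, v}"
  by (induction xs rule: edges_of.induct) auto

lemma rwalk_rev: "sym A \<Longrightarrow> rwalk A xs \<Longrightarrow> rwalk A (rev xs)"
  by (subst successively_rev) (auto elim: successively_mono dest: symD)

lemma rwalk_append: "rwalk A (xs @ y # zs) \<longleftrightarrow> rwalk A (xs @ [y]) \<and> rwalk A (y # zs)"
  by (induction xs) (auto simp: successively_Cons hd_append)

text \<open>The normal form for a cycle through \<open>a\<close> and \<open>b\<close>: both halves
  are read from \<open>a\<close> to \<open>b\<close>, so the second one enters the vertex list
  reversed. Any two paths of a theta graph then yield a cycle in the same form.\<close>

lemma cedges_two_paths: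
  "cedges (a # ys @ b # rev zs) = edges_of (a # ys @ [b]) \<union> edges_of (a # zs @ [b])"
proof -
  have "cedges (a # ys @ b # rev zs) = edges_of ((a # ys) @ b # (rev zs @ [a]))" by (simp add: cedges_def)
  also have "\<dots> = edges_of (a # ys @ [b]) \<union> edges_of (rev (a # zs @ [b]))"
    by (subst edges_of_append) simp
  finally show ?thesis by (simp only: edges_of_rev)
qed

lemma gcycle_two_paths:
  assumes "sym A"
  shows "gcycle A (a # ys @ b # rev zs) \<longleftrightarrow> distinct (a # ys @ b # zs) \<and> (ys \<noteq> [] \<or> zs \<noteq> []) \<and>
    rwalk A (a # ys @ [b]) \<and> rwalk A (a # zs @ [b])"
proof -
  have "rwalk A ((a # ys @ b # rev zs) @ [a]) \<longleftrightarrow> rwalk A ((a # ys) @ b # (rev zs @ [a]))" by simp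
  also have "\<dots> \<longleftrightarrow> rwalk A (a # ys @ [b]) \<and> rwalk A (rev (a # zs @ [b]))"
    by (subst rwalk_append) simp
  also have "rwalk A (rev (a # zs @ [b])) \<longleftrightarrow> rwalk A (a # zs @ [b])"
    using rwalk_rev[OF assms] rev_rev_ident by metis
  finally show ?thesis unfolding gcycle_def
    by (cases ys; cases zs) (auto simp: Suc_le_eq)
qed

lemma cedges_rotate: "cedges (xs @ ys) = cedges (ys @ xs)"
proof (cases "xs = [] \<or> ys = []")
  case False
  then obtain x xs' y ys' where "xs = x # xs'" "ys = y # ys'" by (meson neq_Nil_conv)
  moreover have "edges_of ((x # xs') @ y # (ys' @ [x])) = edges_of ((y # ys') @ x # (xs' @ [y]))"
    using edges_of_append[of "x # xs'" y "ys' @ [x]"] edges_of_append[of "y # ys'" x "xs' @ [y]"] by auto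
  ultimately show ?thesis by (simp add: cedges_def)
qed auto

lemma gcycle_rotate: "gcycle A (xs @ ys) \<Longrightarrow> gcycle A (ys @ xs)"
proof (cases "xs = [] \<or> ys = []")
  case False
  assume g: "gcycle A (xs @ ys)"
  obtain x xs' y ys' where xy: "xs = x # xs'" "ys = y # ys'" using False by (meson neq_Nil_conv)
  have "rwalk A ((x # xs') @ y # (ys' @ [x]))" using g xy by (simp add: gcycle_def)
  then have "rwalk A ((y # ys') @ x # (xs' @ [y]))"
    by (subst rwalk_append, subst (asm) rwalk_append) simp
  then show ?thesis using g xy by (auto simp: gcycle_def)
qed auto

text \<open>Rotate the list until it starts with \<open>a\<close>; the position of \<open>b\<close>
  then separates the two halves.\<close>

lemma gcycle_split:
  assumes "gcycle A xs" "sym A" "a \<in> set xs" "b \<in> set xs" "a \<noteq> b"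
  obtains ys zs where "gcycle A (a # ys @ b # rev zs)" "cedges xs = cedges (a # ys @ b # rev zs)"
    "set xs = set (a # ys @ b # rev zs)" "length xs = length ys + length zs + 2"
proof -
  obtain us vs where xs: "xs = us @ a # vs" using assms(3) by (meson split_list)
  have "b \<in> set (vs @ us)" using xs assms(4,5) by auto
  then obtain ys ws where ws: "vs @ us = ys @ b # ws" by (meson split_list)
  have eq: "(a # vs) @ us = a # ys @ b # rev (rev ws)" using ws by simp
  show thesis
  proof (rule that[of ys "rev ws"])
    show "gcycle A (a # ys @ b # rev (rev ws))" using gcycle_rotate[of A us "a # vs"] assms(1) xs eq by metis
    show "cedges xs = cedges (a # ys @ b # rev (rev ws))" using cedges_rotate[of us "a # vs"] xs eq by metis
    have "set xs = set ((a # vs) @ us)" using xs by auto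
    then show "set xs = set (a # ys @ b # rev (rev ws))" using eq by metis
    have "length xs = length ((a # vs) @ us)" using xs by auto
    then show "length xs = length ys + length (rev ws) + 2" using arg_cong[OF eq, of length] by simp
  qed
qed

text \<open>The paths share only the vertices \<open>a\<close> and \<open>b\<close>, so a common
  edge joins these. A path without repetitions that contains such an edge is that edge alone, and
  the two paths cannot both be.\<close>

lemma edges_of_internally_disjoint:
  assumes "distinct (a # ys @ b # zs)" "ys \<noteq> [] \<or> zs \<noteq> []"
  shows "edges_of (a # ys @ [b]) \<inter> edges_of (a # zs @ [b]) = {}"
proof (rule ccontr)
  assume "\<not> ?thesis"
  then obtain e where e: "e \<in> edges_of (a # ys @ [b])" "e \<in> edges_of (a # zs @ [b])" by blast
  have sub: "e \<subseteq> {a, b}" using edges_of_subset[OF e(1)] edges_of_subset[OF e(2)] assms(1) by auto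
  have "\<exists>x y. x \<noteq> y \<and> e = {x, y}" if "distinct xs" "e \<in> edges_of xs" for xs
    using that by (induction xs rule: edges_of.induct) auto
  then obtain x y where "x \<noteq> y" "e = {x, y}" using e(1) assms(1) by (metis distinct.simps(2) distinct_append distinct1_rotate append_Cons append_assoc append_Nil)
  then have "e = {a, b}" using sub by auto
  then have "ys = []" "zs = []" using e edges_of_ends[of a _ b] assms(1) by auto
  then show False using assms(2) by simp
qed

section \<open>Theta subgraphs of plane graphs\<close>

definition uedges :: "'a pair_pre_digraph \<Rightarrow> 'a set set" where
  "uedges G = {{u, v} | u v. (u, v) \<in> parcs G}"

text \<open>A connected graph with at least three vertices satisfies this iff it has no cut vertex.\<close>

definition nonseparable :: "'a pair_pre_digraph \<Rightarrow> bool" where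
  "nonseparable G \<longleftrightarrow> (\<forall>D c. D \<noteq> {} \<and> D \<subseteq> pverts G \<and> c \<notin> D \<and>
     (\<forall>w \<in> D. \<forall>x. (w, x) \<in> parcs G \<longrightarrow> x \<in> D \<or> x = c) \<longrightarrow> pverts G \<subseteq> insert c D)"

locale plane_graph = pair_graph G for G :: "'a pair_pre_digraph" +
  fixes p :: "'a \<Rightarrow> complex" and \<gamma> :: "'a set \<Rightarrow> real \<Rightarrow> complex"
  assumes drawing: "plane_drawing G p \<gamma>"
begin

abbreviation "A \<equiv> parcs G"
abbreviation "V \<equiv> pverts G"

definition img :: "'a set set \<Rightarrow> complex set" where
  "img F = (\<Union>e\<in>F. path_image (\<gamma> e))"

definition open_arc :: "'a set \<Rightarrow> complex set" where
  "open_arc e = path_image (\<gamma> e) - p ` e"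

text \<open>Membership is tested on the open arc, so that an edge running through the interior
  counts even when its ends lie on the cycle.\<close>

definition edges_in :: "'a set set \<Rightarrow> 'a set set" where
  "edges_in F = {e \<in> uedges G. open_arc e \<subseteq> inside (img F)}"

definition verts_in :: "'a set set \<Rightarrow> 'a set" where
  "verts_in F = {v \<in> V. p v \<in> inside (img F)}"

lemma sym_A: "sym A"
  by (rule symI) (rule arcs_symmetric)

lemma inj_p: "inj_on p V"
  using drawing by (simp add: plane_drawing_def)

lemma uedges_subset: "e \<in> uedges G \<Longrightarrow> e \<subseteq> V"
  by (auto simp: uedges_def dest: in_arcsD1 in_arcsD2)

lemma finite_uedges: "finite (uedges G)"
proof -
  have "uedges G = (\<lambda>(u, v). {u, v}) ` A" by (auto simp: uedges_def)
  then show ?thesis using pair_finite_arcs by simp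
qed

text \<open>The drawing has one curve for both orientations of an edge and fixes its ends only as a
  set, so the curve may have to be reversed.\<close>

lemma edge_arc:
  assumes "(u, v) \<in> A"
  shows "arc_between (p u) (p v) (path_image (\<gamma> {u, v}))"
proof -
  let ?g = "\<gamma> {u, v}"
  have a: "Path_Connected.arc ?g" "{pathstart ?g, pathfinish ?g} = {p u, p v}"
    using drawing assms by (auto simp: plane_drawing_def)
  then have "(pathstart ?g = p u \<and> pathfinish ?g = p v) \<or> (pathstart ?g = p v \<and> pathfinish ?g = p u)"
    by (auto simp: doubleton_eq_iff)
  then show ?thesis
    using a(1) arc_between_sym by (metis arc_between_def)
qed

lemma edge_verts:
  assumes "e \<in> uedges G"
  shows "path_image (\<gamma> e) \<inter> p ` V = p ` e"
proof -
  obtain u v where e: "e = {u, v}" "(u, v) \<in> A" using assms by (auto simp: uedges_def)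
  have "\<forall>(u, v) \<in> A. path_image (\<gamma> {u, v}) \<inter> p ` V = {p u, p v}"
    using drawing unfolding plane_drawing_def by (simp add: case_prod_beta)
  from bspec[OF this e(2)] show ?thesis by (simp add: e(1))
qed

lemma edge_meet:
  assumes "e \<in> uedges G" "f \<in> uedges G" "e \<noteq> f"
  shows "path_image (\<gamma> e) \<inter> path_image (\<gamma> f) = p ` (e \<inter> f)"
proof -
  obtain u v where e: "e = {u, v}" "(u, v) \<in> A" using assms by (auto simp: uedges_def)
  obtain x y where f: "f = {x, y}" "(x, y) \<in> A" using assms by (auto simp: uedges_def)
  have "\<forall>(u, v) \<in> A. \<forall>(x, y) \<in> A. {u, v} \<noteq> {x, y} \<longrightarrow>
    path_image (\<gamma> {u, v}) \<inter> path_image (\<gamma> {x, y}) = p ` ({u, v} \<inter> {x, y})"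
    using drawing unfolding plane_drawing_def by (elim conjE)
  from bspec[OF this e(2)]
  have "\<forall>(x, y) \<in> A. {u, v} \<noteq> {x, y} \<longrightarrow>
    path_image (\<gamma> {u, v}) \<inter> path_image (\<gamma> {x, y}) = p ` ({u, v} \<inter> {x, y})"
    by (simp only: prod.case)
  from bspec[OF this f(2)] show ?thesis
    using assms(3) unfolding e(1) f(1) by (simp only: prod.case simp_thms)
qed

lemma img_Un: "img (F \<union> F') = img F \<union> img F'"
  by (auto simp: img_def)

lemma img_verts: "F \<subseteq> uedges G \<Longrightarrow> img F \<inter> p ` V = p ` \<Union> F"
  using edge_verts unfolding img_def by blast

lemma vertex_in_img: "F \<subseteq> uedges G \<Longrightarrow> v \<in> V \<Longrightarrow> p v \<in> img F \<longleftrightarrow> v \<in> \<Union> F"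
proof -
  assume F: "F \<subseteq> uedges G" and v: "v \<in> V"
  have "p v \<in> img F \<longleftrightarrow> p v \<in> p ` \<Union> F" using img_verts[OF F] v by blast
  also have "\<dots> \<longleftrightarrow> v \<in> \<Union> F"
    using uedges_subset F v by (intro inj_on_image_mem_iff[OF inj_p]) auto
  finally show ?thesis .
qed

text \<open>Distinct edges meet only in common ends. Since \<open>F\<close> and \<open>F'\<close>
  share no edge, every common point comes from two distinct edges.\<close>

lemma img_Int:
  assumes "F \<subseteq> uedges G" "F' \<subseteq> uedges G" "F \<inter> F' = {}"
  shows "img F \<inter> img F' = p ` (\<Union> F \<inter> \<Union> F')"
proof
  show "img F \<inter> img F' \<subseteq> p ` (\<Union> F \<inter> \<Union> F')"
  proof
    fix z assume "z \<in> img F \<inter> img F'"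
    then obtain e f where "e \<in> F" "f \<in> F'" "z \<in> path_image (\<gamma> e) \<inter> path_image (\<gamma> f)"
      unfolding img_def by blast
    then have "z \<in> p ` (e \<inter> f)" using edge_meet[of e f] assms by blast
    then show "z \<in> p ` (\<Union> F \<inter> \<Union> F')" using \<open>e \<in> F\<close> \<open>f \<in> F'\<close> by blast
  qed
  show "p ` (\<Union> F \<inter> \<Union> F') \<subseteq> img F \<inter> img F'"
    using vertex_in_img[OF assms(1)] vertex_in_img[OF assms(2)] uedges_subset assms by blast
qed

lemma open_arc_connected:
  assumes "e \<in> uedges G"
  shows "connected (open_arc e)" "open_arc e \<noteq> {}"
proof -
  obtain u v where e: "e = {u, v}" "(u, v) \<in> A" using assms by (auto simp: uedges_def)
  then have "open_arc e = path_image (\<gamma> {u, v}) - {p u, p v}" by (auto simp: open_arc_def)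
  then show "connected (open_arc e)" "open_arc e \<noteq> {}"
    using arc_between_connected[OF edge_arc[OF e(2)]] by auto
qed

lemma open_arc_disjoint_img:
  assumes "e \<in> uedges G" "F \<subseteq> uedges G" "e \<notin> F"
  shows "open_arc e \<inter> img F = {}"
  using edge_meet[OF assms(1)] assms(2,3) unfolding open_arc_def img_def by blast

lemma open_arc_subset_img: "e \<in> F \<Longrightarrow> open_arc e \<subseteq> img F"
  unfolding open_arc_def img_def by blast

lemma open_arc_no_vertex: "e \<in> uedges G \<Longrightarrow> open_arc e \<inter> p ` V = {}"
  using edge_verts unfolding open_arc_def by blast

lemma edges_of_uedges: "rwalk A xs \<Longrightarrow> edges_of xs \<subseteq> uedges G"
  using edges_of_rwalk unfolding uedges_def by blast

lemma cedges_uedges: "gcycle A xs \<Longrightarrow> cedges xs \<subseteq> uedges G"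
  by (simp add: gcycle_def cedges_def edges_of_uedges)

lemma Union_cedges: "gcycle A xs \<Longrightarrow> \<Union> (cedges xs) = set xs"
  by (cases xs) (auto simp: gcycle_def cedges_def Union_edges_of)

text \<open>Arcs are joined one by one: as no vertex repeats, the first edge meets the rest of the
  path only in its second vertex.\<close>

lemma walk_arc:
  "distinct xs \<Longrightarrow> rwalk A xs \<Longrightarrow> 2 \<le> length xs \<Longrightarrow>
     arc_between (p (hd xs)) (p (last xs)) (img (edges_of xs))"
proof (induction xs rule: edges_of.induct)
  case (1 u v xs)
  have uv: "(u, v) \<in> A" using 1 by auto
  show ?case
  proof (cases "xs = []")
    case True
    then show ?thesis using edge_arc[OF uv] by (simp add: img_def)
  next
    case False
    then have len: "2 \<le> length (v # xs)" by (cases xs) auto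
    have IH: "arc_between (p v) (p (last (v # xs))) (img (edges_of (v # xs)))"
      using "1.IH" "1.prems" len by simp
    have w: "rwalk A (v # xs)" using 1 by simp
    have "{u, v} \<notin> edges_of (v # xs)" using edges_of_subset[of "{u, v}" "v # xs"] 1 by auto
    then have "img {{u, v}} \<inter> img (edges_of (v # xs)) = p ` ({u, v} \<inter> set (v # xs))"
      using img_Int[of "{{u, v}}" "edges_of (v # xs)"] edges_of_uedges[OF w] Union_edges_of[OF len] uv
      by (auto simp: uedges_def)
    then have "path_image (\<gamma> {u, v}) \<inter> img (edges_of (v # xs)) \<subseteq> {p v}"
      using 1(2) by (auto simp: img_def)
    then show ?thesis using arc_between_join[OF edge_arc[OF uv] IH] by (simp add: img_def)
  qed
qed auto

text \<open>Three internally disjoint paths from \<open>a\<close> to \<open>b\<close>, given by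
  their inner vertices. At most one path may be a single edge, so any two of them form a
  cycle.\<close>

definition theta :: "'a \<Rightarrow> 'a \<Rightarrow> 'a list \<Rightarrow> 'a list \<Rightarrow> 'a list \<Rightarrow> bool" where
  "theta a b xs ys zs \<longleftrightarrow> distinct (a # b # xs @ ys @ zs) \<and>
     (xs \<noteq> [] \<or> ys \<noteq> []) \<and> (xs \<noteq> [] \<or> zs \<noteq> []) \<and> (ys \<noteq> [] \<or> zs \<noteq> []) \<and>
     rwalk A (a # xs @ [b]) \<and> rwalk A (a # ys @ [b]) \<and> rwalk A (a # zs @ [b])"

lemma theta_perm:
  assumes "theta a b xs ys zs"
  shows "theta a b ys xs zs" "theta a b xs zs ys" "theta a b zs ys xs"
  using assms by (auto simp: theta_def)

lemma theta_arc:
  assumes "theta a b xs ys zs"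
  shows "arc_between (p a) (p b) (img (edges_of (a # xs @ [b])))"
  using walk_arc[of "a # xs @ [b]"] assms by (auto simp: theta_def)

lemma theta_edges_disjoint:
  assumes "theta a b xs ys zs"
  shows "edges_of (a # xs @ [b]) \<inter> edges_of (a # ys @ [b]) = {}"
  using assms by (intro edges_of_internally_disjoint) (auto simp: theta_def)

lemma theta_meet:
  assumes "theta a b xs ys zs"
  shows "img (edges_of (a # xs @ [b])) \<inter> img (edges_of (a # ys @ [b])) = {p a, p b}"
proof -
  have "img (edges_of (a # xs @ [b])) \<inter> img (edges_of (a # ys @ [b])) =
    p ` (set (a # xs @ [b]) \<inter> set (a # ys @ [b]))"
    using assms theta_edges_disjoint[OF assms]
    by (subst img_Int) (auto simp: theta_def edges_of_uedges Union_edges_of)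
  also have "set (a # xs @ [b]) \<inter> set (a # ys @ [b]) = {a, b}"
    using assms by (auto simp: theta_def)
  finally show ?thesis by simp
qed

lemma theta_gcycle:
  assumes "theta a b xs ys zs"
  shows "gcycle A (a # xs @ b # rev ys)"
  using assms by (subst gcycle_two_paths[OF sym_A]) (auto simp: theta_def)

text \<open>The path \<open>zs\<close> cuts the disc of the other two paths into two discs. Any
  other edge inside has a connected open arc that misses all three paths, so it lies in exactly one
  half. The second claim covers only one half; exchanging \<open>xs\<close> and \<open>ys\<close>
  gives the other.\<close>

lemma theta_interior:
  assumes th: "theta a b xs ys zs"
    and ins: "img (edges_of (a # zs @ [b])) \<inter> inside (img (cedges (a # xs @ b # rev ys))) \<noteq> {}"
  shows "edges_in (cedges (a # xs @ b # rev ys)) =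
      edges_in (cedges (a # xs @ b # rev zs)) \<union> edges_in (cedges (a # ys @ b # rev zs)) \<union>
      edges_of (a # zs @ [b])" (is "edges_in ?C = edges_in ?C1 \<union> edges_in ?C2 \<union> ?Q")
    and "edges_in (cedges (a # xs @ b # rev zs)) \<inter> edges_of (a # zs @ [b]) = {}"
    and "verts_in (cedges (a # xs @ b # rev ys)) =
      verts_in (cedges (a # xs @ b # rev zs)) \<union> verts_in (cedges (a # ys @ b # rev zs)) \<union> set zs"
    and "verts_in (cedges (a # xs @ b # rev zs)) \<inter> verts_in (cedges (a # ys @ b # rev zs)) = {}"
    and "(verts_in (cedges (a # xs @ b # rev zs)) \<union> verts_in (cedges (a # ys @ b # rev zs))) \<inter> set zs = {}"
proof -
  define S1 where "S1 = img (edges_of (a # xs @ [b]))"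
  define S2 where "S2 = img (edges_of (a # ys @ [b]))"
  define S where "S = img (edges_of (a # zs @ [b]))"
  have C: "img ?C = S1 \<union> S2" "img ?C1 = S1 \<union> S" "img ?C2 = S2 \<union> S"
    by (simp_all add: cedges_two_paths img_Un S1_def S2_def S_def)
  note th' = theta_perm[OF th] theta_perm(2)[OF theta_perm(1)[OF th]] theta_perm(1)[OF theta_perm(2)[OF th]]
  have arcs: "arc_between (p a) (p b) S1" "arc_between (p a) (p b) S2" "arc_between (p a) (p b) S"
    unfolding S1_def S2_def S_def by (fact theta_arc[OF th] theta_arc[OF th'(1)] theta_arc[OF th'(3)])+
  have meets: "S1 \<inter> S2 = {p a, p b}" "S1 \<inter> S = {p a, p b}" "S2 \<inter> S = {p a, p b}"
    unfolding S1_def S2_def S_def by (fact theta_meet[OF th] theta_meet[OF th'(2)] theta_meet[OF th'(4)])+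
  have "S \<inter> inside (S1 \<union> S2) \<noteq> {}" using ins C S_def by simp
  note split = theta_inside[OF arcs meets this]
  have w: "?Q \<subseteq> uedges G" and wx: "edges_of (a # xs @ [b]) \<subseteq> uedges G" and wy: "edges_of (a # ys @ [b]) \<subseteq> uedges G"
    using th by (simp_all add: theta_def edges_of_uedges)
  have Cs: "?C1 \<subseteq> uedges G" "?C2 \<subseteq> uedges G" using w wx wy by (auto simp: cedges_two_paths)
  have ab: "a \<in> V" "b \<in> V" and zsV: "set zs \<subseteq> V"
    using uedges_subset w Union_edges_of[of "a # zs @ [b]"] by fastforce+
  have sub: "e \<in> edges_in ?C1 \<union> edges_in ?C2" if e: "e \<in> edges_in ?C" "e \<notin> ?Q" for e
  proof -
    have eu: "e \<in> uedges G" and oin: "open_arc e \<subseteq> inside (S1 \<union> S2)" using e C by (auto simp: edges_in_def)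
    have dQ: "open_arc e \<inter> S = {}" using open_arc_disjoint_img[OF eu w e(2)] S_def by simp
    then have d: "open_arc e \<inter> (S1 \<union> S) = {}" "open_arc e \<inter> (S2 \<union> S) = {}"
      using oin inside_no_overlap[of "S1 \<union> S2"] by blast+
    have "open_arc e \<inter> inside (S1 \<union> S) \<noteq> {} \<or> open_arc e \<inter> inside (S2 \<union> S) \<noteq> {}"
      using oin split(2) dQ open_arc_connected(2)[OF eu] by blast
    then have "open_arc e \<subseteq> inside (S1 \<union> S) \<or> open_arc e \<subseteq> inside (S2 \<union> S)"
      using connected_subset_inside[OF open_arc_connected(1)[OF eu] d(1)]
        connected_subset_inside[OF open_arc_connected(1)[OF eu] d(2)] by blast
    then show ?thesis using eu C by (auto simp: edges_in_def)
  qed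
  have Qin: "?Q \<subseteq> edges_in ?C"
  proof
    fix e assume e: "e \<in> ?Q"
    then have "open_arc e \<subseteq> S - {p a, p b}"
      using open_arc_subset_img[of e ?Q] open_arc_no_vertex[of e] w ab S_def by blast
    then have "open_arc e \<subseteq> inside (S1 \<union> S2)" using split(2) by blast
    then show "e \<in> edges_in ?C" using e w C by (auto simp: edges_in_def)
  qed
  show "edges_in ?C = edges_in ?C1 \<union> edges_in ?C2 \<union> ?Q"
  proof
    show "edges_in ?C \<subseteq> edges_in ?C1 \<union> edges_in ?C2 \<union> ?Q" using sub by blast
    show "edges_in ?C1 \<union> edges_in ?C2 \<union> ?Q \<subseteq> edges_in ?C"
      using Qin split(2) C by (auto simp: edges_in_def)
  qed
  show "edges_in ?C1 \<inter> ?Q = {}"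
  proof -
    have False if "e \<in> edges_in ?C1" "e \<in> ?Q" for e
    proof -
      have "open_arc e \<subseteq> inside (img ?C1)" "open_arc e \<subseteq> img ?C1" "e \<in> uedges G"
        using that open_arc_subset_img[of e ?C1] by (auto simp: edges_in_def cedges_two_paths)
      then show False using open_arc_connected(2) inside_no_overlap[of "img ?C1"] by blast
    qed
    then show ?thesis by blast
  qed
  have vS: "p v \<in> S - {p a, p b} \<longleftrightarrow> v \<in> set zs" if "v \<in> V" for v
  proof -
    have "p v \<in> S \<longleftrightarrow> v \<in> set (a # zs @ [b])"
      unfolding S_def using vertex_in_img[OF w that] Union_edges_of[of "a # zs @ [b]"] by simp
    moreover have "p v = p a \<longleftrightarrow> v = a" "p v = p b \<longleftrightarrow> v = b"
      using inj_p that ab by (auto dest: inj_onD)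
    ultimately show ?thesis using th by (auto simp: theta_def)
  qed
  show "verts_in ?C = verts_in ?C1 \<union> verts_in ?C2 \<union> set zs"
    using vS zsV C split(2) by (auto simp: verts_in_def)
  show "verts_in ?C1 \<inter> verts_in ?C2 = {}"
    using split(1) C by (auto simp: verts_in_def)
  show "(verts_in ?C1 \<union> verts_in ?C2) \<inter> set zs = {}"
  proof -
    have "p v \<notin> S1 \<union> S" if "v \<in> verts_in ?C1" for v
      using that C inside_no_overlap[of "S1 \<union> S"] by (auto simp only: verts_in_def mem_Collect_eq)
    moreover have "p v \<notin> S2 \<union> S" if "v \<in> verts_in ?C2" for v
      using that C inside_no_overlap[of "S2 \<union> S"] by (auto simp only: verts_in_def mem_Collect_eq)
    moreover have "p v \<in> S" if "v \<in> set zs" for v using vS that zsV by blast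
    ultimately show ?thesis by blast
  qed
qed

text \<open>By \<open>theta_outside\<close> one of the old paths runs inside the cycle made of the
  new path and the other old path. By \<open>theta_interior\<close> this cycle keeps all interior
  edges of the old one and gains those of the enclosed path.\<close>

lemma theta_exterior:
  assumes th: "theta a b xs ys zs"
    and out: "img (edges_of (a # zs @ [b])) \<inter> outside (img (cedges (a # xs @ b # rev ys))) \<noteq> {}"
  shows "\<exists>cs. gcycle A cs \<and> edges_in (cedges (a # xs @ b # rev ys)) \<subset> edges_in (cedges cs)"
proof -
  define S1 where "S1 = img (edges_of (a # xs @ [b]))"
  define S2 where "S2 = img (edges_of (a # ys @ [b]))"
  define S where "S = img (edges_of (a # zs @ [b]))"
  note th' = theta_perm[OF th] theta_perm(2)[OF theta_perm(1)[OF th]] theta_perm(1)[OF theta_perm(2)[OF th]]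
  have arcs: "arc_between (p a) (p b) S1" "arc_between (p a) (p b) S2" "arc_between (p a) (p b) S"
    unfolding S1_def S2_def S_def by (fact theta_arc[OF th] theta_arc[OF th'(1)] theta_arc[OF th'(3)])+
  have meets: "S1 \<inter> S2 = {p a, p b}" "S1 \<inter> S = {p a, p b}" "S2 \<inter> S = {p a, p b}"
    unfolding S1_def S2_def S_def by (fact theta_meet[OF th] theta_meet[OF th'(2)] theta_meet[OF th'(4)])+
  have "S \<inter> outside (S1 \<union> S2) \<noteq> {}" using out by (simp add: cedges_two_paths img_Un S1_def S2_def S_def)
  from theta_outside[OF arcs meets this] show ?thesis
  proof
    assume "S2 \<inter> inside (S1 \<union> S) \<noteq> {}"
    then have i: "img (edges_of (a # ys @ [b])) \<inter> inside (img (cedges (a # xs @ b # rev zs))) \<noteq> {}"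
      by (simp add: cedges_two_paths img_Un S1_def S2_def S_def)
    have "edges_of (a # ys @ [b]) \<noteq> {}" by (cases ys) auto
    then show ?thesis
      using theta_interior(1,2)[OF th'(2) i] theta_gcycle[OF th'(2)] by blast
  next
    assume "S1 \<inter> inside (S2 \<union> S) \<noteq> {}"
    then have i: "img (edges_of (a # xs @ [b])) \<inter> inside (img (cedges (a # ys @ b # rev zs))) \<noteq> {}"
      by (simp add: cedges_two_paths img_Un S1_def S2_def S_def)
    have eq: "cedges (a # xs @ b # rev ys) = cedges (a # ys @ b # rev xs)"
      by (simp add: cedges_two_paths Un_commute)
    have "edges_of (a # xs @ [b]) \<noteq> {}" by (cases xs) auto
    then show ?thesis
      unfolding eq using theta_interior(1,2)[OF th'(4) i] theta_gcycle[OF th'(4)] by blast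
  qed
qed

end

section \<open>The edge bound for graphs without cut vertices\<close>

text \<open>The walk is built backwards from \<open>y\<close>. If the new start already occurs on
  it, the part before that occurrence is dropped.\<close>

lemma rtrancl_distinct_walk:
  assumes "(x, y) \<in> r\<^sup>*"
  shows "\<exists>ws. ws \<noteq> [] \<and> hd ws = x \<and> last ws = y \<and> distinct ws \<and> rwalk r ws \<and> set ws \<subseteq> r\<^sup>* `` {x}"
  using assms
proof (induction rule: converse_rtrancl_induct)
  case base
  then show ?case by (intro exI[of _ "[y]"]) auto
next
  case (step x z)
  then obtain ws where ws: "ws \<noteq> []" "hd ws = z" "last ws = y" "distinct ws" "rwalk r ws"
    "set ws \<subseteq> r\<^sup>* `` {z}" by blast
  have sub: "r\<^sup>* `` {z} \<subseteq> r\<^sup>* `` {x}" using step(1) by (auto intro: converse_rtrancl_into_rtrancl)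
  show ?case
  proof (cases "x \<in> set ws")
    case True
    then obtain us vs where "ws = us @ x # vs" by (meson split_list)
    then show ?thesis using ws sub rwalk_append[of r us x vs] by (intro exI[of _ "x # vs"]) auto
  next
    case False
    then show ?thesis using ws sub step(1) by (intro exI[of _ "x # ws"]) (auto simp: successively_Cons)
  qed
qed

lemma nonseparableD:
  assumes "nonseparable G" "D \<noteq> {}" "D \<subseteq> pverts G" "c \<notin> D"
    and "\<And>w x. w \<in> D \<Longrightarrow> (w, x) \<in> parcs G \<Longrightarrow> x \<in> D \<or> x = c"
  shows "pverts G \<subseteq> insert c D"
  using assms by (simp add: nonseparable_def)

context plane_graph
begin

section \<open>Ears of a cycle on a given side\<close>

lemma connected_subset_side:
  assumes "R = inside S \<or> R = outside S" "connected T" "T \<inter> S = {}" "T \<inter> R \<noteq> {}"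
  shows "T \<subseteq> R"
  using assms(1,4) connected_subset_inside[OF assms(2,3)] connected_subset_outside[OF assms(2,3)] by blast

text \<open>Cut the cycle at the ends of the ear. The assumption \<open>new\<close> prevents an ear
  consisting of one edge from coinciding with a half of the cycle.\<close>

lemma theta_of_ear:
  assumes cyc: "gcycle A xs" and ab: "a \<in> set xs" "b \<in> set xs" "a \<noteq> b"
    and zs: "set zs \<inter> set xs = {}" "distinct zs" "rwalk A (a # zs @ [b])"
    and new: "zs \<noteq> [] \<or> {a, b} \<notin> cedges xs"
  shows "\<exists>xs' ys. theta a b xs' ys zs \<and> cedges xs = cedges (a # xs' @ b # rev ys) \<and>
    length xs = length xs' + length ys + 2"
proof -
  obtain xs' ys where s: "gcycle A (a # xs' @ b # rev ys)" "cedges xs = cedges (a # xs' @ b # rev ys)"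
    "set xs = set (a # xs' @ b # rev ys)" "length xs = length xs' + length ys + 2"
    by (rule gcycle_split[OF cyc sym_A ab])
  have d: "distinct (a # xs' @ b # ys)" and w: "rwalk A (a # xs' @ [b])" "rwalk A (a # ys @ [b])"
    and ne: "xs' \<noteq> [] \<or> ys \<noteq> []"
    using s(1) unfolding gcycle_two_paths[OF sym_A] by blast+
  have "{a, b} \<in> cedges xs" if "xs' = [] \<or> ys = []"
    unfolding s(2) cedges_two_paths using that by (elim disjE) simp_all
  then have "xs' \<noteq> [] \<or> zs \<noteq> []" "ys \<noteq> [] \<or> zs \<noteq> []" using new by blast+
  moreover have "distinct (a # b # xs' @ ys @ zs)" using d zs(1,2) unfolding s(3) by auto
  ultimately have th: "theta a b xs' ys zs" unfolding theta_def using w ne zs(3) by blast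
  show ?thesis using th s(2,4) by blast
qed

lemma edge_Int_cycle:
  assumes "gcycle A xs" "(u, v) \<in> A" "{u, v} \<notin> cedges xs"
  shows "path_image (\<gamma> {u, v}) \<inter> img (cedges xs) = p ` ({u, v} \<inter> set xs)"
proof -
  have "{{u, v}} \<subseteq> uedges G" using assms(2) by (auto simp: uedges_def)
  from img_Int[OF this cedges_uedges[OF assms(1)]] show ?thesis
    using assms(3) Union_cedges[OF assms(1)] by (simp add: img_def)
qed

lemma cycle_subset_verts:
  assumes "gcycle A xs"
  shows "set xs \<subseteq> V"
  using Union_cedges[OF assms] cedges_uedges[OF assms] uedges_subset by blast

text \<open>Let \<open>D\<close> be the component of \<open>u\<close> after deletion of the cycle's
  vertices. Its edges miss the cycle, so \<open>D\<close> stays on the side \<open>R\<close>. If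
  \<open>D\<close> were attached to at most one vertex \<open>c\<close> of the cycle, then
  \<open>c\<close> would separate \<open>D\<close> from the rest of the cycle. Two attachments and a
  path within \<open>D\<close> give the ear.\<close>

lemma ear_off_cycle:
  assumes ns: "nonseparable G" and cyc: "gcycle A xs" and u: "u \<in> V" "u \<notin> set xs" "p u \<in> R"
    and R: "R = inside (img (cedges xs)) \<or> R = outside (img (cedges xs))"
  shows "\<exists>a b zs. a \<in> set xs \<and> b \<in> set xs \<and> a \<noteq> b \<and> zs \<noteq> [] \<and> set zs \<inter> set xs = {} \<and> distinct zs \<and>
    rwalk A (a # zs @ [b]) \<and> img (edges_of (a # zs @ [b])) \<inter> R \<noteq> {}"
proof -
  have set_xs: "3 \<le> card (set xs)" using cyc by (simp add: gcycle_def distinct_card)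
  define r where "r = {(x, y) \<in> A. x \<notin> set xs \<and> y \<notin> set xs}"
  define D where "D = r\<^sup>* `` {u}"
  have D: "w \<in> V \<and> w \<notin> set xs \<and> p w \<in> R" if "w \<in> D" for w
  proof -
    have "(u, w) \<in> r\<^sup>*" using that by (simp add: D_def)
    then show ?thesis
    proof (induction rule: rtrancl_induct)
      case base
      then show ?case using u by simp
    next
      case (step y z)
      then have yz: "(y, z) \<in> A" "y \<notin> set xs" "z \<notin> set xs" by (auto simp: r_def)
      have "{y, z} \<notin> cedges xs" using Union_cedges[OF cyc] yz by blast
      then have "path_image (\<gamma> {y, z}) \<inter> img (cedges xs) = {}" using edge_Int_cycle[OF cyc] yz by simp
      moreover have con: "connected (path_image (\<gamma> {y, z}))" using arc_between_connected(1)[OF edge_arc[OF yz(1)]] .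
      moreover have "{p y, p z} \<subseteq> path_image (\<gamma> {y, z})" using edge_verts[of "{y, z}"] yz by (auto simp: uedges_def)
      ultimately have "path_image (\<gamma> {y, z}) \<subseteq> R" 
        using connected_subset_side[OF R con] step.IH by blast
      then show ?case using \<open>{p y, p z} \<subseteq> path_image (\<gamma> {y, z})\<close> yz in_arcsD2 by blast
    qed
  qed
  have "u \<in> D" by (simp add: D_def)
  have "\<exists>a b w w'. a \<in> set xs \<and> b \<in> set xs \<and> a \<noteq> b \<and> w \<in> D \<and> w' \<in> D \<and> (w, a) \<in> A \<and> (w', b) \<in> A"
  proof (rule ccontr)
    assume none: "\<not> ?thesis"
    define attached where "attached = (\<lambda>a. a \<in> set xs \<and> (\<exists>w\<in>D. (w, a) \<in> A))"
    have "hd xs \<in> set xs" using set_xs by (cases xs) auto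
    \<comment> \<open>If \<open>D\<close> is attached to the cycle at all, \<open>c\<close> is such
      an attachment; otherwise any vertex of the cycle serves.\<close>
    then obtain c where c: "c \<in> set xs" "\<And>a. attached a \<Longrightarrow> attached c"
      unfolding attached_def by blast
    have "x \<in> D \<or> x = c" if wx: "w \<in> D" "(w, x) \<in> A" for w x
    proof (cases "x \<in> set xs")
      case True
      then have "attached x" using wx unfolding attached_def by blast
      then have "attached c" by (rule c(2))
      then show ?thesis using none \<open>attached x\<close> unfolding attached_def by blast
    next
      case False
      then have "(w, x) \<in> r" using wx D by (auto simp: r_def)
      then show ?thesis using wx by (auto simp: D_def)
    qed
    moreover have "D \<noteq> {}" "D \<subseteq> V" "c \<notin> D" using \<open>u \<in> D\<close> D c(1) by auto
    ultimately have "V \<subseteq> insert c D" using nonseparableD[OF ns, of D c] by simp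
    then have "set xs \<subseteq> {c}" using D cycle_subset_verts[OF cyc] by blast
    then show False using set_xs card_mono[of "{c}" "set xs"] by simp
  qed
  then obtain a b w w' where ab: "a \<in> set xs" "b \<in> set xs" "a \<noteq> b" and w: "w \<in> D" "w' \<in> D" "(w, a) \<in> A" "(w', b) \<in> A"
    by blast
  have "sym r" using sym_A by (auto simp: r_def sym_def)
  then have "(w, w') \<in> r\<^sup>*" using w(1,2) unfolding D_def
    by (metis Image_singleton_iff rtrancl_trans sym_rtrancl symD)
  then obtain zs where zs: "zs \<noteq> []" "hd zs = w" "last zs = w'" "distinct zs" "rwalk r zs"
    "set zs \<subseteq> r\<^sup>* `` {w}" using rtrancl_distinct_walk by metis
  have "r\<^sup>* `` {w} \<subseteq> D" using w(1) by (auto simp: D_def)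
  then have "set zs \<inter> set xs = {}" using zs(6) D by blast
  moreover have "rwalk A zs" using zs(5) by (auto elim: successively_mono simp: r_def)
  then have "rwalk A (a # zs @ [b])"
    using w zs symD[OF sym_A w(3)] by (auto simp: successively_Cons successively_append_iff hd_append)
  moreover have "p w \<in> img (edges_of (a # zs @ [b]))"
  proof -
    have "edges_of (a # zs @ [b]) \<subseteq> uedges G" using calculation by (intro edges_of_uedges)
    moreover have "w \<in> \<Union> (edges_of (a # zs @ [b]))"
      using zs(1,2) by (subst Union_edges_of) auto
    ultimately show ?thesis using vertex_in_img D[OF w(1)] by blast
  qed
  ultimately show ?thesis using ab zs D[OF w(1)] by blast
qed

text \<open>If an end of \<open>e\<close> is off the cycle, that end lies in \<open>R\<close> and
  has an ear, which need not use \<open>e\<close>. Otherwise \<open>e\<close> itself is a chord and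
  forms the ear.\<close>

lemma ear_at_edge:
  assumes ns: "nonseparable G" and cyc: "gcycle A xs"
    and e: "e \<in> uedges G" "e \<notin> cedges xs" "open_arc e \<inter> R \<noteq> {}"
    and R: "R = inside (img (cedges xs)) \<or> R = outside (img (cedges xs))"
  obtains a b xs' ys zs where "theta a b xs' ys zs" "cedges xs = cedges (a # xs' @ b # rev ys)"
    "length xs = length xs' + length ys + 2" "img (edges_of (a # zs @ [b])) \<inter> R \<noteq> {}"
proof -
  note conclude = that
  have *: thesis if uv: "(u, v) \<in> A" "e = {u, v}" "u \<notin> set xs" for u v
  proof -
    \<comment> \<open>At most the end \<open>v\<close> lies on the cycle. Without it the arc misses
      the cycle and still contains \<open>p u\<close>, so \<open>p u\<close> lies on the same side
      as the open arc.\<close>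
    let ?T = "path_image (\<gamma> {u, v}) - {p v}"
    have T: "connected ?T" using arc_between_connected_Diff_end[OF edge_arc[OF uv(1)]] .
    have "path_image (\<gamma> {u, v}) \<inter> img (cedges xs) = p ` ({u, v} \<inter> set xs)"
      using edge_Int_cycle[OF cyc] uv e by simp
    then have "?T \<inter> img (cedges xs) = {}" using uv(3) by blast
    moreover have "?T \<inter> R \<noteq> {}" using e(3) uv(2) by (auto simp: open_arc_def)
    ultimately have "?T \<subseteq> R" using connected_subset_side[OF R T] by blast
    moreover have "p u \<noteq> p v" using inj_onD[OF inj_p] in_arcsD1 in_arcsD2 no_loops' uv(1) by metis
    moreover have "p u \<in> path_image (\<gamma> {u, v})" using edge_verts[OF e(1)] uv(2) by auto
    ultimately have "p u \<in> R" by blast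
    from ear_off_cycle[OF ns cyc in_arcsD1[OF uv(1)] uv(3) this R]
    obtain a b zs where z: "a \<in> set xs" "b \<in> set xs" "a \<noteq> b" "zs \<noteq> []" "set zs \<inter> set xs = {}" "distinct zs"
      "rwalk A (a # zs @ [b])" "img (edges_of (a # zs @ [b])) \<inter> R \<noteq> {}" by blast
    obtain xs' ys where th: "theta a b xs' ys zs" "cedges xs = cedges (a # xs' @ b # rev ys)"
      "length xs = length xs' + length ys + 2"
      using theta_of_ear[OF cyc z(1-3) z(5-7)] z(4) by blast
    show thesis by (rule conclude[OF th z(8)])
  qed
  obtain u v where uv: "(u, v) \<in> A" "e = {u, v}" using e(1) by (auto simp: uedges_def)
  consider "u \<notin> set xs" | "v \<notin> set xs" | "u \<in> set xs" "v \<in> set xs" by blast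
  then show thesis
  proof cases
    case 1
    then show ?thesis by (rule *[OF uv])
  next
    case 2
    then show ?thesis using *[of v u] uv symD[OF sym_A] by (simp add: insert_commute)
  next
    case 3
    have "u \<noteq> v" using no_loops' uv(1) .
    obtain xs' ys where th: "theta u v xs' ys []" "cedges xs = cedges (u # xs' @ v # rev ys)"
      "length xs = length xs' + length ys + 2"
      using theta_of_ear[OF cyc 3 \<open>u \<noteq> v\<close>, of "[]"] uv e(2) by auto
    have "img (edges_of (u # [] @ [v])) \<inter> R \<noteq> {}"
      using e(3) uv(2) by (auto simp: img_def open_arc_def)
    then show ?thesis by (rule conclude[OF th])
  qed
qed

text \<open>The girth is written \<open>h + 2\<close> to avoid subtraction. Induction on the edges
  inside: with none, the girth bound suffices. Otherwise an ear with \<open>k\<close> inner vertices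
  splits the cycle. It contributes \<open>k + 1\<close> edges and \<open>k\<close> vertices and adds
  \<open>2 * k + 2\<close> to the total length of the boundaries. As
  \<open>h * (k + 1) + 2 * k + 2 = (h + 2) * k + (h + 2)\<close>, the sum of the two inequalities is
  exactly the one required, the last summand cancelling one of the two constants.\<close>

lemma interior_bound:
  assumes ns: "nonseparable G" and girth: "\<And>xs. gcycle A xs \<Longrightarrow> h + 2 \<le> length xs"
    and "gcycle A xs"
  shows "h * card (edges_in (cedges xs)) + (h + 2) \<le> (h + 2) * card (verts_in (cedges xs)) + length xs"
  using assms(3)
proof (induction "card (edges_in (cedges xs))" arbitrary: xs rule: less_induct)
  case less
  have fin: "finite (edges_in F)" "finite (verts_in F)" for F
    using finite_uedges pair_finite_verts by (auto simp: edges_in_def verts_in_def)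
  show ?case
  proof (cases "edges_in (cedges xs) = {}")
    case True
    then show ?thesis using girth[OF less.prems] by simp
  next
    case False
    then obtain e where e: "e \<in> uedges G" "open_arc e \<subseteq> inside (img (cedges xs))"
      by (auto simp: edges_in_def)
    then have ne: "open_arc e \<inter> inside (img (cedges xs)) \<noteq> {}" using open_arc_connected(2) by blast
    have eC: "e \<notin> cedges xs"
      using ne open_arc_subset_img[of e "cedges xs"] inside_no_overlap[of "img (cedges xs)"] by blast
    obtain a b xs' ys zs where th: "theta a b xs' ys zs"
      and ce: "cedges xs = cedges (a # xs' @ b # rev ys)"
      and len: "length xs = length xs' + length ys + 2"
      and ins: "img (edges_of (a # zs @ [b])) \<inter> inside (img (cedges xs)) \<noteq> {}"
      by (rule ear_at_edge[OF ns less.prems e(1) eC ne]) auto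
    let ?C1 = "cedges (a # xs' @ b # rev zs)" and ?C2 = "cedges (a # ys @ b # rev zs)"
    let ?Q = "edges_of (a # zs @ [b])"
    note th' = theta_perm[OF th] theta_perm(2)[OF theta_perm(1)[OF th]]
    note int = theta_interior[OF th ins[unfolded ce], folded ce]
    \<comment> \<open>With the two halves exchanged, \<open>theta_interior\<close> also shows that
      the ear is not inside the second cycle, so both interiors are strictly smaller.\<close>
    have ce': "cedges (a # ys @ b # rev xs') = cedges xs" unfolding ce by (simp add: cedges_two_paths Un_commute)
    note int' = theta_interior[OF th'(1), unfolded ce', OF ins]
    have "?Q \<noteq> {}" by (cases zs) auto
    then have "edges_in ?C1 \<subset> edges_in (cedges xs)" "edges_in ?C2 \<subset> edges_in (cedges xs)"
      using int(1,2) int'(2) by blast+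
    then have lt: "card (edges_in ?C1) < card (edges_in (cedges xs))" "card (edges_in ?C2) < card (edges_in (cedges xs))"
      by (auto intro!: psubset_card_mono fin)
    have IH1: "h * card (edges_in ?C1) + (h + 2) \<le> (h + 2) * card (verts_in ?C1) + (length xs' + length zs + 2)"
      using less.hyps[OF lt(1) theta_gcycle[OF th'(2)]] by simp
    have IH2: "h * card (edges_in ?C2) + (h + 2) \<le> (h + 2) * card (verts_in ?C2) + (length ys + length zs + 2)"
      using less.hyps[OF lt(2) theta_gcycle[OF th'(4)]] by simp
    have "card ?Q \<le> length zs + 1" using card_edges_of[of "a # zs @ [b]"] by simp
    then have m: "card (edges_in (cedges xs)) \<le> card (edges_in ?C1) + card (edges_in ?C2) + (length zs + 1)"
      unfolding int(1) using card_Un_le[of "edges_in ?C1 \<union> edges_in ?C2" ?Q]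
        card_Un_le[of "edges_in ?C1" "edges_in ?C2"] by linarith
    have "card (set zs) = length zs" using th by (simp add: theta_def distinct_card)
    then have n: "card (verts_in (cedges xs)) = card (verts_in ?C1) + card (verts_in ?C2) + length zs"
      unfolding int(3) using int(4,5) by (simp add: card_Un_disjoint fin)
    have "h * card (edges_in (cedges xs)) \<le> h * (card (edges_in ?C1) + card (edges_in ?C2) + (length zs + 1))"
      using m by (rule mult_le_mono2)
    then show ?thesis using IH1 IH2 n len by (simp add: algebra_simps)
  qed
qed

text \<open>In a cycle with the most interior edges, an edge outside would yield an outer ear and,
  by \<open>theta_exterior\<close>, a better cycle. So all edges lie on or inside the cycle, and
  \<open>interior_bound\<close> counts them.\<close>

lemma nonseparable_edge_bound:
  assumes ns: "nonseparable G" and girth: "\<And>xs. gcycle A xs \<Longrightarrow> h + 2 \<le> length xs"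
    and "gcycle A xs0"
  shows "h * card (uedges G) + (h + 2) \<le> (h + 2) * card V"
proof -
  have fin: "finite (edges_in F)" "finite (verts_in F)" for F
    using finite_uedges pair_finite_verts by (auto simp: edges_in_def verts_in_def)
  have "card (edges_in (cedges ys)) \<le> card (uedges G)" for ys
    using finite_uedges by (auto simp: edges_in_def intro: card_mono)
  then obtain xs where cyc: "gcycle A xs"
    and max: "\<And>ys. gcycle A ys \<Longrightarrow> card (edges_in (cedges ys)) \<le> card (edges_in (cedges xs))"
    using ex_has_greatest_nat[of "gcycle A" xs0 "\<lambda>ys. card (edges_in (cedges ys))" "Suc (card (uedges G))"] assms(3) le_imp_less_Suc by blast
  have all: "e \<in> cedges xs \<or> e \<in> edges_in (cedges xs)" if e: "e \<in> uedges G" for e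
  proof (rule ccontr)
    assume "\<not> ?thesis"
    then have ne: "e \<notin> cedges xs" "e \<notin> edges_in (cedges xs)" by auto
    have d: "open_arc e \<inter> img (cedges xs) = {}"
      using open_arc_disjoint_img[OF e cedges_uedges[OF cyc] ne(1)] .
    have "open_arc e \<inter> inside (img (cedges xs)) = {}"
      using connected_subset_inside[OF open_arc_connected(1)[OF e] d] ne(2) e by (auto simp: edges_in_def)
    then have "open_arc e \<inter> outside (img (cedges xs)) \<noteq> {}"
      using d open_arc_connected(2)[OF e] inside_Un_outside[of "img (cedges xs)"] by blast
    then obtain a b xs' ys zs where th: "theta a b xs' ys zs" and ce: "cedges xs = cedges (a # xs' @ b # rev ys)"
      and out: "img (edges_of (a # zs @ [b])) \<inter> outside (img (cedges xs)) \<noteq> {}"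
      by (rule ear_at_edge[OF ns cyc e ne(1)]) auto
    obtain cs where "gcycle A cs" "edges_in (cedges xs) \<subset> edges_in (cedges cs)"
      using theta_exterior[OF th out[unfolded ce], folded ce] by blast
    then show False using max psubset_card_mono[OF fin(1)] by (meson leD)
  qed
  then have "card (uedges G) \<le> card (cedges xs) + card (edges_in (cedges xs))"
    using card_mono[of "cedges xs \<union> edges_in (cedges xs)" "uedges G"] fin
      card_Un_le[of "cedges xs" "edges_in (cedges xs)"]
    by (force simp: cedges_def finite_edges_of)
  moreover have "card (cedges xs) \<le> length xs" using card_edges_of[of "xs @ [hd xs]"] by (simp add: cedges_def)
  ultimately have m: "card (uedges G) \<le> length xs + card (edges_in (cedges xs))" by simp
  have "set xs \<inter> verts_in (cedges xs) = {}"
    using vertex_in_img[OF cedges_uedges[OF cyc]] Union_cedges[OF cyc] inside_no_overlap[of "img (cedges xs)"]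
    unfolding verts_in_def by blast
  then have "card (set xs) + card (verts_in (cedges xs)) = card (set xs \<union> verts_in (cedges xs))"
    by (simp add: card_Un_disjoint fin)
  also have "\<dots> \<le> card V"
    using cycle_subset_verts[OF cyc] pair_finite_verts by (intro card_mono) (auto simp: verts_in_def)
  finally have n: "length xs + card (verts_in (cedges xs)) \<le> card V"
    using cyc by (simp add: gcycle_def distinct_card)
  have "h * card (uedges G) \<le> h * (length xs + card (edges_in (cedges xs)))"
    using m by (rule mult_le_mono2)
  moreover have "(h + 2) * (length xs + card (verts_in (cedges xs))) \<le> (h + 2) * card V"
    using n by (rule mult_le_mono2)
  ultimately show ?thesis
    using interior_bound[OF ns girth cyc] girth[OF cyc] by (simp add: algebra_simps)
qed

end

section \<open>The edge bound for plane graphs\<close>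

definition induced :: "'a pair_pre_digraph \<Rightarrow> 'a set \<Rightarrow> 'a pair_pre_digraph" where
  "induced G W = \<lparr>pverts = pverts G \<inter> W, parcs = parcs G \<inter> W \<times> W\<rparr>"

lemma induced_simps [simp]:
  "pverts (induced G W) = pverts G \<inter> W" "parcs (induced G W) = parcs G \<inter> W \<times> W"
  by (simp_all add: induced_def)

lemma pair_graph_induced:
  assumes "pair_graph G"
  shows "pair_graph (induced G W)"
proof -
  interpret pair_graph G by fact
  show ?thesis
  proof
    show "symmetric (induced G W)"
      using arcs_symmetric by (auto simp: symmetric_def intro!: symI)
  qed (use pair_finite_verts pair_finite_arcs pair_no_loops in \<open>auto dest: in_arcsD1 in_arcsD2\<close>)
qed

lemma plane_drawing_induced:
  assumes "plane_drawing G p \<gamma>" "pair_graph G"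
  shows "plane_drawing (induced G W) p \<gamma>"
proof -
  interpret plane_graph G p \<gamma>
    using assms by (simp add: plane_graph_def plane_graph_axioms_def)
  have 1: "path_image (\<gamma> {u, v}) \<inter> p ` (V \<inter> W) = {p u, p v}"
    if "(u, v) \<in> A" "u \<in> W" "v \<in> W" for u v
  proof -
    have "path_image (\<gamma> {u, v}) \<inter> p ` V = p ` {u, v}"
      using that(1) by (intro edge_verts) (auto simp: uedges_def)
    moreover have "{u, v} \<subseteq> V \<inter> W" using that in_arcsD1 in_arcsD2 by blast
    ultimately show ?thesis by blast
  qed
  have 2: "Path_Connected.arc (\<gamma> {u, v}) \<and> {pathstart (\<gamma> {u, v}), pathfinish (\<gamma> {u, v})} = {p u, p v}"
    if "(u, v) \<in> A" for u v
    using assms(1) that by (auto simp: plane_drawing_def)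
  have 3: "path_image (\<gamma> {u, v}) \<inter> path_image (\<gamma> {x, y}) = p ` ({u, v} \<inter> {x, y})"
    if "(u, v) \<in> A" "(x, y) \<in> A" "{u, v} \<noteq> {x, y}" for u v x y
    using that by (intro edge_meet) (auto simp: uedges_def)
  show ?thesis
    unfolding plane_drawing_def induced_simps
  proof (intro conjI)
    show "inj_on p (V \<inter> W)" using inj_p by (rule inj_on_subset) simp
    show "\<forall>(u, v) \<in> A \<inter> W \<times> W.
        Path_Connected.arc (\<gamma> {u, v}) \<and>
        {pathstart (\<gamma> {u, v}), pathfinish (\<gamma> {u, v})} = {p u, p v} \<and>
        path_image (\<gamma> {u, v}) \<inter> p ` (V \<inter> W) = {p u, p v}"
    proof clarify
      fix u v assume "(u, v) \<in> A" "u \<in> W" "v \<in> W"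
      then show "Path_Connected.arc (\<gamma> {u, v}) \<and>
        {pathstart (\<gamma> {u, v}), pathfinish (\<gamma> {u, v})} = {p u, p v} \<and>
        path_image (\<gamma> {u, v}) \<inter> p ` (V \<inter> W) = {p u, p v}"
        using 1[of u v] 2[of u v] by (intro conjI) simp_all
    qed
    show "\<forall>(u, v) \<in> A \<inter> W \<times> W. \<forall>(x, y) \<in> A \<inter> W \<times> W. {u, v} \<noteq> {x, y} \<longrightarrow>
        path_image (\<gamma> {u, v}) \<inter> path_image (\<gamma> {x, y}) = p ` ({u, v} \<inter> {x, y})"
      by clarify (rule 3)
  qed
qed

lemma gcycle_mono: "gcycle A xs \<Longrightarrow> A \<subseteq> B \<Longrightarrow> gcycle B xs"
  unfolding gcycle_def by (auto elim: successively_mono)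

lemma rwalk_prefix: "rwalk A (xs @ ys) \<Longrightarrow> rwalk A xs"
  by (simp add: successively_append_iff)

text \<open>Apply nonseparability to \<open>D = {v}\<close>: a sole neighbour \<open>c\<close>, or
  any other vertex if \<open>v\<close> is isolated, would cut off \<open>v\<close>, leaving room for
  only two vertices.\<close>

lemma nonseparable_two_neighbors:
  assumes "nonseparable G" "finite (pverts G)" "3 \<le> card (pverts G)" "v \<in> pverts G"
    and "\<And>x. (v, x) \<in> parcs G \<Longrightarrow> x \<noteq> v"
  shows "\<exists>x y. (v, x) \<in> parcs G \<and> (v, y) \<in> parcs G \<and> x \<noteq> y"
proof (rule ccontr)
  assume not: "\<not> ?thesis"
  have "\<exists>c. c \<noteq> v \<and> (\<forall>x. (v, x) \<in> parcs G \<longrightarrow> x = c)"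
  proof (cases "\<exists>c. (v, c) \<in> parcs G")
    case True
    then show ?thesis using not assms(5) by blast
  next
    case False
    have "\<not> pverts G \<subseteq> {v}" using assms(3) card_mono[of "{v}" "pverts G"] by auto
    then show ?thesis using False by blast
  qed
  then obtain c where c: "c \<noteq> v" "\<And>x. (v, x) \<in> parcs G \<Longrightarrow> x = c" by blast
  have "pverts G \<subseteq> insert c {v}"
    by (rule nonseparableD[OF assms(1)]) (use c assms(4) in auto)
  then have "card (pverts G) \<le> card {c, v}" by (intro card_mono) auto
  also have "\<dots> \<le> 2" by (simp add: card_insert_if)
  finally show False using assms(3) by simp
qed

text \<open>The initial vertex of a longest path has all its neighbours on the path.\<close>

lemma exists_gcycle:
  assumes "pair_graph G" "pverts G \<noteq> {}"
    and two: "\<And>v. v \<in> pverts G \<Longrightarrow> \<exists>x y. (v, x) \<in> parcs G \<and> (v, y) \<in> parcs G \<and> x \<noteq> y"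
  shows "\<exists>xs. gcycle (parcs G) xs"
proof -
  interpret pair_graph G by fact
  define P where "P = (\<lambda>xs. xs \<noteq> [] \<and> distinct xs \<and> set xs \<subseteq> pverts G \<and> rwalk (parcs G) xs)"
  obtain v where "v \<in> pverts G" using assms(2) by blast
  then have "P [v]" by (simp add: P_def)
  moreover have "length xs < Suc (card (pverts G))" if "P xs" for xs
    using that card_mono[OF pair_finite_verts, of "set xs"] by (simp add: P_def distinct_card)
  ultimately obtain xs where xs: "P xs" and max: "\<And>ys. P ys \<Longrightarrow> length ys \<le> length xs"
    using ex_has_greatest_nat[of P "[v]" length] by blast
  then obtain x ys where xy: "xs = x # ys" by (auto simp: P_def neq_Nil_conv)
  have nb: "z \<in> set ys" if "(x, z) \<in> parcs G" for z
  proof (rule ccontr)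
    assume "z \<notin> set ys"
    then have "P (z # xs)"
      using xs that arcs_symmetric[OF that] in_arcsD2[OF that] no_loops'[OF that]
      by (auto simp: P_def xy successively_Cons)
    then show False using max by fastforce
  qed
  have "x \<in> pverts G" using xs by (simp add: P_def xy)
  then obtain y1 y2 where y12: "(x, y1) \<in> parcs G" "(x, y2) \<in> parcs G" "y1 \<noteq> y2" using two by blast
  then obtain y0 ys' where ys: "ys = y0 # ys'" using nb by (cases ys) auto
  \<comment> \<open>At most one of the two neighbours is \<open>y0\<close>. The other lies further
    along the path, so closing up there uses at least three vertices.\<close>
  have "y1 \<in> set ys' \<or> y2 \<in> set ys'" using nb[OF y12(1)] nb[OF y12(2)] y12(3) ys by auto
  then obtain y where y: "(x, y) \<in> parcs G" "y \<in> set ys'" using y12 by blast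
  then obtain us vs where us: "ys' = us @ y # vs" by (meson split_list)
  have "rwalk (parcs G) ((x # y0 # us @ [y]) @ vs)" using xs by (simp add: P_def xy ys us)
  then have "rwalk (parcs G) ((x # y0 # us) @ y # [])" using rwalk_prefix by fastforce
  then have "rwalk (parcs G) ((x # y0 # us) @ y # [x])"
    using rwalk_append[of "parcs G" "x # y0 # us" y "[x]"] arcs_symmetric[OF y(1)] by simp
  then have "gcycle (parcs G) (x # y0 # us @ [y])"
    using xs by (simp add: gcycle_def P_def xy ys us)
  then show ?thesis by blast
qed

text \<open>Induction on the number of vertices. If \<open>c\<close> separates \<open>D\<close> from
  the rest, the parts induced by \<open>insert c D\<close> and \<open>V - D\<close> cover all edges
  and share at most \<open>c\<close>. Counting \<open>c\<close> twice costs \<open>h + 2\<close>,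
  which is the constant present in both bounds but needed only once. As \<open>c\<close> need not be
  a vertex, disconnected graphs are included.\<close>

theorem plane_graph_edge_bound:
  assumes "pair_graph G" "plane_drawing G p \<gamma>" "pverts G \<noteq> {}"
    and "\<And>xs. gcycle (parcs G) xs \<Longrightarrow> h + 2 \<le> length xs"
  shows "h * card (uedges G) + (h + 2) \<le> (h + 2) * card (pverts G)"
  using assms
proof (induction "card (pverts G)" arbitrary: G rule: less_induct)
  case less
  interpret plane_graph G p \<gamma>
    using less.prems by (simp add: plane_graph_def plane_graph_axioms_def)
  have pos: "1 \<le> card V" using less.prems(3) pair_finite_verts by (simp add: Suc_le_eq card_gt_0_iff)
  consider "card V < 3" | "3 \<le> card V" "nonseparable G" | "\<not> nonseparable G" by linarith
  then show ?case
  proof cases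
    case 1
    have eq: "e = V" "card V = 2" if e: "e \<in> uedges G" for e
    proof -
      obtain u v where "e = {u, v}" "(u, v) \<in> A" using e by (auto simp: uedges_def)
      then have "card e = 2" using no_loops'[of u v] by simp
      moreover have "e \<subseteq> V" using uedges_subset[OF e] .
      ultimately show "e = V" "card V = 2"
        using card_seteq[OF pair_finite_verts, of e] card_mono[OF pair_finite_verts, of e] 1 by auto
    qed
    show ?thesis
    proof (cases "uedges G = {}")
      case True
      then show ?thesis using mult_le_mono2[OF pos, of "h + 2"] by simp
    next
      case False
      then have "uedges G = {V}" "card V = 2" using eq by blast+
      then show ?thesis by simp
    qed
  next
    case 2
    have "\<exists>x y. (v, x) \<in> A \<and> (v, y) \<in> A \<and> x \<noteq> y" if "v \<in> V" for v
      using nonseparable_two_neighbors[OF 2(2) pair_finite_verts 2(1) that] no_loops' by metis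
    then obtain xs where "gcycle A xs" using exists_gcycle[OF less.prems(1,3)] by blast
    then show ?thesis using nonseparable_edge_bound[OF 2(2) less.prems(4)] by blast
  next
    case 3
    then obtain D c where D: "D \<noteq> {}" "D \<subseteq> V" "c \<notin> D" "\<not> V \<subseteq> insert c D"
      and cut: "\<And>w x. w \<in> D \<Longrightarrow> (w, x) \<in> A \<Longrightarrow> x \<in> D \<or> x = c"
      unfolding nonseparable_def by blast
    have IH: "h * card (uedges (induced G W)) + (h + 2) \<le> (h + 2) * card (V \<inter> W)"
      if "V \<inter> W \<subset> V" "V \<inter> W \<noteq> {}" for W
    proof -
      have "card (V \<inter> W) < card V" using that(1) pair_finite_verts by (rule psubset_card_mono[rotated])
      moreover have "h + 2 \<le> length xs" if "gcycle (A \<inter> W \<times> W) xs" for xs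
        using less.prems(4) gcycle_mono[OF that] by blast
      ultimately show ?thesis
        using less.hyps[of "induced G W"] that(2) pair_graph_induced[OF less.prems(1)]
          plane_drawing_induced[OF less.prems(2,1)] by simp
    qed
    let ?W1 = "insert c D" and ?W2 = "V - D"
    have IH1: "h * card (uedges (induced G ?W1)) + (h + 2) \<le> (h + 2) * card (V \<inter> ?W1)"
      by (rule IH) (use D in auto)
    have IH2: "h * card (uedges (induced G ?W2)) + (h + 2) \<le> (h + 2) * card (V \<inter> ?W2)"
      by (rule IH) (use D in auto)
    have "e \<in> uedges (induced G ?W1) \<union> uedges (induced G ?W2)" if eG: "e \<in> uedges G" for e
    proof -
      obtain u v where e: "e = {u, v}" "(u, v) \<in> A" using eG by (auto simp: uedges_def)
      have "(u, v) \<in> A \<inter> ?W1 \<times> ?W1 \<or> (u, v) \<in> A \<inter> ?W2 \<times> ?W2"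
        using e(2) cut[of u v] cut[of v u] arcs_symmetric[OF e(2)] in_arcsD1[OF e(2)] in_arcsD2[OF e(2)] by blast
      then show ?thesis using e(1) by (auto simp: uedges_def)
    qed
    then have sub: "uedges G \<subseteq> uedges (induced G ?W1) \<union> uedges (induced G ?W2)" by blast
    have "uedges (induced G W) \<subseteq> uedges G" for W by (auto simp: uedges_def)
    then have "card (uedges G) \<le> card (uedges (induced G ?W1) \<union> uedges (induced G ?W2))"
      using sub finite_uedges by (intro card_mono) (auto intro: finite_subset)
    also have "\<dots> \<le> card (uedges (induced G ?W1)) + card (uedges (induced G ?W2))"
      by (rule card_Un_le)
    finally have "h * card (uedges G) \<le> h * (card (uedges (induced G ?W1)) + card (uedges (induced G ?W2)))"
      by (rule mult_le_mono2)
    moreover have "card (V \<inter> ?W1) + card (V \<inter> ?W2) \<le> card V + 1"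
    proof -
      have fD: "finite D" using D(2) pair_finite_verts by (rule finite_subset)
      have "card (V \<inter> ?W1) \<le> card ?W1" using fD by (intro card_mono) auto
      also have "\<dots> = card D + 1" using D(3) fD by simp
      finally have "card (V \<inter> ?W1) \<le> card D + 1" .
      moreover have "V \<inter> ?W2 = V - D" by blast
      moreover have "card (V - D) + card D = card V"
        using card_Diff_subset[OF fD D(2)] card_mono[OF pair_finite_verts D(2)] by simp
      ultimately show ?thesis by simp
    qed
    then have "(h + 2) * (card (V \<inter> ?W1) + card (V \<inter> ?W2)) \<le> (h + 2) * (card V + 1)"
      by (rule mult_le_mono2)
    ultimately show ?thesis using IH1 IH2 by (simp add: algebra_simps)
  qed
qed

section \<open>Proper conflict-free coloring of sparse graphs\<close>

lemma ex_uncovered: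
  assumes "finite F" "card F < card S"
  shows "\<exists>c \<in> S. c \<notin> F"
  using assms card_mono[of F S] by (metis leD subsetI)

text \<open>
  An old vertex, with old neighbourhood \<open>N\<close>, keeps its uniquely occurring color as long as a new
  neighbour \<open>s\<close> avoids one color \<open>f\<close>.
\<close>

lemma ex_forbidden_color:
  assumes "N \<noteq> {} \<Longrightarrow> \<exists>c. card {u \<in> N. \<phi> u = c} = 1"
  shows "\<exists>f. \<forall>\<psi> s. s \<notin> N \<longrightarrow> (\<forall>u\<in>N. \<psi> u = \<phi> u) \<longrightarrow> \<psi> s \<noteq> f \<longrightarrow>
    (\<exists>c. card {u \<in> insert s N. \<psi> u = c} = 1)"
proof (cases "N = {}")
  case True
  have "card {u \<in> {s}. \<psi> u = \<psi> s} = 1" for \<psi> :: "'a \<Rightarrow> 'b" and s by (simp add: Collect_conv_if)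
  then show ?thesis using True by blast
next
  case False
  then obtain c where c: "card {u \<in> N. \<phi> u = c} = 1" using assms by blast
  have "card {u \<in> insert s N. \<psi> u = c} = 1" if "s \<notin> N" "\<forall>u\<in>N. \<psi> u = \<phi> u" "\<psi> s \<noteq> c" for \<psi> s
  proof -
    have "{u \<in> insert s N. \<psi> u = c} = {u \<in> N. \<phi> u = c}" using that by auto
    then show ?thesis using c by simp
  qed
  then show ?thesis by blast
qed

section \<open>Extending a coloring to reducible vertices\<close>

locale partial_coloring = pair_graph G for G :: "'a pair_pre_digraph" +
  fixes W :: "'a set" and \<phi> :: "'a \<Rightarrow> 'c"
  assumes W: "W \<subseteq> pverts G" and col: "proper_conflict_free_coloring (induced G W) \<phi>"
begin

text \<open>The color supplied by \<open>ex_forbidden_color\<close>. It depends on \<open>w\<close>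
  and the old coloring alone, so it can be excluded before the new colors are chosen.\<close>

definition forbidden :: "'a \<Rightarrow> 'c" where
  "forbidden w = (SOME f. \<forall>\<psi> s. s \<notin> neighborhood G w \<inter> W \<longrightarrow>
     (\<forall>u\<in>neighborhood G w \<inter> W. \<psi> u = \<phi> u) \<longrightarrow> \<psi> s \<noteq> f \<longrightarrow>
     (\<exists>c. card {u \<in> insert s (neighborhood G w \<inter> W). \<psi> u = c} = 1))"

lemma conflict_free_W:
  assumes "w \<in> W" "neighborhood G w \<inter> W \<noteq> {}"
  shows "\<exists>c. card {u \<in> neighborhood G w \<inter> W. \<phi> u = c} = 1"
proof -
  have "neighborhood (induced G W) w = neighborhood G w \<inter> W"
    using assms(1) by (auto simp: neighborhood_def)
  moreover have "w \<in> pverts (induced G W)" using assms(1) W by auto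
  ultimately show ?thesis
    using col assms(2) unfolding proper_conflict_free_coloring_def by metis
qed

lemma conflict_free_if_not_forbidden:
  assumes "w \<in> W" "s \<notin> W" "\<And>u. u \<in> W \<Longrightarrow> \<psi> u = \<phi> u" "\<psi> s \<noteq> forbidden w"
    and N: "neighborhood G w = insert s (neighborhood G w \<inter> W)"
  shows "\<exists>c. card {u \<in> neighborhood G w. \<psi> u = c} = 1"
proof -
  from someI_ex[OF ex_forbidden_color[OF conflict_free_W[OF assms(1)]], folded forbidden_def]
  have "\<exists>c. card {u \<in> insert s (neighborhood G w \<inter> W). \<psi> u = c} = 1"
    using assms(2-4) by simp
  then show ?thesis by (simp only: N[symmetric])
qed

text \<open>By \<open>single\<close>, an old vertex gains at most one new neighbour. If it gains
  none, its neighbourhood is colored as before; if it gains one, avoiding \<open>forbidden w\<close>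
  keeps a unique color around it.\<close>

lemma extend:
  assumes agree: "\<And>w. w \<in> W \<Longrightarrow> \<psi> w = \<phi> w"
    and new: "\<And>s w. s \<in> pverts G - W \<Longrightarrow> w \<in> W \<Longrightarrow> (s, w) \<in> parcs G \<Longrightarrow> \<psi> s \<noteq> \<phi> w \<and> \<psi> s \<noteq> forbidden w"
    and single: "\<And>w s t. w \<in> W \<Longrightarrow> s \<notin> W \<Longrightarrow> t \<notin> W \<Longrightarrow> (w, s) \<in> parcs G \<Longrightarrow> (w, t) \<in> parcs G \<Longrightarrow> s = t"
    and proper: "\<And>s t. s \<in> pverts G - W \<Longrightarrow> t \<in> pverts G - W \<Longrightarrow> (s, t) \<in> parcs G \<Longrightarrow> \<psi> s \<noteq> \<psi> t"
    and cf: "\<And>s. s \<in> pverts G - W \<Longrightarrow> neighborhood G s \<noteq> {} \<Longrightarrow> \<exists>c. card {u \<in> neighborhood G s. \<psi> u = c} = 1"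
  shows "proper_conflict_free_coloring G \<psi>"
proof -
  show ?thesis
    unfolding proper_conflict_free_coloring_def
  proof (intro conjI ballI impI)
    have "\<psi> u \<noteq> \<psi> v" if uv: "(u, v) \<in> parcs G" for u v
    proof -
      have uv': "u \<in> pverts G" "v \<in> pverts G" "(v, u) \<in> parcs G"
        using in_arcsD1 in_arcsD2 arcs_symmetric uv by blast+
      have "\<phi> u \<noteq> \<phi> v" if "u \<in> W" "v \<in> W"
        using col uv that by (auto simp: proper_conflict_free_coloring_def proper_coloring_def)
      then show ?thesis
        using agree new[of u v] new[of v u] proper[of u v] uv uv' by (cases "u \<in> W"; cases "v \<in> W") auto
    qed
    then show "proper_coloring G \<psi>" by (auto simp: proper_coloring_def)
  next
    fix v assume v: "v \<in> pverts G" "neighborhood G v \<noteq> {}"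
    show "\<exists>c. card {u \<in> neighborhood G v. \<psi> u = c} = 1"
    proof (cases "v \<in> W")
      case False
      then show ?thesis using cf v by blast
    next
      case True
      show ?thesis
      proof (cases "neighborhood G v \<subseteq> W")
        case True
        then have "neighborhood G v \<inter> W = neighborhood G v" by blast
        moreover have "{u \<in> neighborhood G v. \<psi> u = c} = {u \<in> neighborhood G v. \<phi> u = c}" for c
          using agree True by auto
        ultimately show ?thesis using conflict_free_W[OF \<open>v \<in> W\<close>] v(2) by simp
      next
        case False
        then obtain s where s: "(v, s) \<in> parcs G" "s \<notin> W" by (auto simp: neighborhood_def)
        have "t = s" if "t \<in> neighborhood G v" "t \<notin> W" for t
          using single[OF \<open>v \<in> W\<close> that(2) s(2)] that(1) s(1) by (simp add: neighborhood_def)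
        moreover have "s \<in> neighborhood G v" using s(1) by (simp add: neighborhood_def)
        ultimately have "neighborhood G v = insert s (neighborhood G v \<inter> W)" by blast
        moreover have "\<psi> s \<noteq> forbidden v"
          using new[of s v] s True arcs_symmetric[OF s(1)] in_arcsD2[OF s(1)] by blast
        ultimately show ?thesis using conflict_free_if_not_forbidden[OF True s(2) agree] by blast
      qed
    qed
  qed
qed

lemma extend_leaf:
  assumes v: "v \<in> pverts G" "W = pverts G - {v}" and deg: "card (neighborhood G v) \<le> 1"
    and L: "3 \<le> card L"
  shows "\<exists>c\<in>L. proper_conflict_free_coloring G (\<phi>(v := c))"
proof -
  have fin: "finite (neighborhood G v)"
    using pair_finite_verts by (rule rev_finite_subset) (auto simp: neighborhood_def dest: in_arcsD2)
  then consider "neighborhood G v = {}" | x where "neighborhood G v = {x}"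
    using deg by (metis card_0_eq card_1_singletonE le_antisym less_one linorder_le_less_linear)
  \<comment> \<open>If \<open>v\<close> is isolated, \<open>x\<close> is arbitrary and excluding its
    two colors does no harm.\<close>
  then obtain x where x: "neighborhood G v = {} \<or> neighborhood G v = {x}" by metis
  have "card {\<phi> x, forbidden x} < card L" using L by (simp add: card_insert_if)
  then obtain c where c: "c \<in> L" "c \<noteq> \<phi> x" "c \<noteq> forbidden x"
    using ex_uncovered[of "{\<phi> x, forbidden x}" L] by auto
  have N: "y = x" if "(v, y) \<in> parcs G" for y using x that by (auto simp: neighborhood_def)
  have "proper_conflict_free_coloring G (\<phi>(v := c))"
  proof (rule extend)
    show "\<exists>d. card {u \<in> neighborhood G s. (\<phi>(v := c)) u = d} = 1"
      if "s \<in> pverts G - W" "neighborhood G s \<noteq> {}" for s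
    proof -
      have "neighborhood G s = {x}" using that v(2) x by auto
      then have "{u \<in> neighborhood G s. (\<phi>(v := c)) u = (\<phi>(v := c)) x} = {x}" by auto
      then show ?thesis by (intro exI[of _ "(\<phi>(v := c)) x"]) simp
    qed
  qed (use v c N in_arcsD2 no_loops'[of v v] in auto)
  then show ?thesis using c(1) by blast
qed

text \<open>Color \<open>u\<close> first, then \<open>v\<close>. Since \<open>c\<close> differs from
  \<open>\<phi> y\<close>, the neighbours of \<open>v\<close> get distinct colors, and since
  \<open>d\<close> differs from \<open>\<phi> x\<close>, so do those of \<open>u\<close>. The
  condition that \<open>x\<close> and \<open>y\<close> differ leaves each old vertex with at most
  one new neighbour.\<close>

lemma extend_adjacent_two_vertices:
  assumes uv: "neighborhood G u = {x, v}" "neighborhood G v = {u, y}" and W_eq: "W = pverts G - {u, v}"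
    and dist: "x \<noteq> y" "x \<noteq> v" "u \<noteq> y"
    and L: "5 \<le> card Lu" "5 \<le> card Lv"
  shows "\<exists>c\<in>Lu. \<exists>d\<in>Lv. proper_conflict_free_coloring G (\<phi>(u := c, v := d))"
proof -
  have arcs: "(u, z) \<in> parcs G \<longleftrightarrow> z = x \<or> z = v" "(v, z) \<in> parcs G \<longleftrightarrow> z = u \<or> z = y" for z
    using uv by (auto simp: neighborhood_def)
  have "(u, v) \<in> parcs G" "(u, x) \<in> parcs G" "(v, y) \<in> parcs G" using arcs by auto
  note in_arcsD1[OF this(1)] in_arcsD2[OF this(1)] in_arcsD2[OF this(2)] in_arcsD2[OF this(3)]
    no_loops'[OF this(1)] no_loops'[OF this(2)] no_loops'[OF this(3)]
  note facts = this
  have arcs': "(z, u) \<in> parcs G \<longleftrightarrow> z = x \<or> z = v" "(z, v) \<in> parcs G \<longleftrightarrow> z = u \<or> z = y" for z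
    using arcs arcs_symmetric by blast+
  have "card {\<phi> x, forbidden x, \<phi> y} < card Lu" using L by (simp add: card_insert_if)
  then obtain c where c: "c \<in> Lu" "c \<notin> {\<phi> x, forbidden x, \<phi> y}"
    using ex_uncovered[of "{\<phi> x, forbidden x, \<phi> y}" Lu] by auto
  have "card {\<phi> y, forbidden y, \<phi> x, c} < card Lv" using L by (simp add: card_insert_if)
  then obtain d where d: "d \<in> Lv" "d \<notin> {\<phi> y, forbidden y, \<phi> x, c}"
    using ex_uncovered[of "{\<phi> y, forbidden y, \<phi> x, c}" Lv] by auto
  have "proper_conflict_free_coloring G (\<phi>(u := c, v := d))"
  proof (rule extend)
    show "\<exists>e. card {z \<in> neighborhood G s. (\<phi>(u := c, v := d)) z = e} = 1"
      if s: "s \<in> pverts G - W" "neighborhood G s \<noteq> {}" for s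
    proof -
      consider "s = u" | "s = v" using s W_eq by blast
      then show ?thesis
      proof cases
        case 1
        have "{z \<in> neighborhood G s. (\<phi>(u := c, v := d)) z = d} = {v}"
          using 1 uv d dist facts by auto
        then show ?thesis by (intro exI[of _ d]) simp
      next
        case 2
        have "{z \<in> neighborhood G s. (\<phi>(u := c, v := d)) z = c} = {u}"
          using 2 uv c d dist facts by auto
        then show ?thesis by (intro exI[of _ c]) simp
      qed
    qed
    show "s = t" if "w \<in> W" "s \<notin> W" "t \<notin> W" "(w, s) \<in> parcs G" "(w, t) \<in> parcs G" for w s t
    proof -
      have "s \<in> {u, v}" "t \<in> {u, v}" using that W_eq in_arcsD2 by blast+
      moreover have "(w, u) \<in> parcs G \<Longrightarrow> w = x" "(w, v) \<in> parcs G \<Longrightarrow> w = y"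
        using arcs'(1)[of w] arcs'(2)[of w] that(1) W_eq by blast+
      ultimately show ?thesis using that(4,5) dist(1) by blast
    qed
  qed (use W_eq c d dist facts arcs in auto)
  then show ?thesis using c(1) d(1) by blast
qed

end

text \<open>
  Give each vertex \<open>v\<close> the charge \<open>5 * deg v - 12\<close> and let it send charge 1 to each neighbour of
  degree 2. If all degrees are at least 2 and no two vertices of degree 2 are adjacent, no final
  charge is negative.
\<close>

lemma ex_reducible:
  assumes "pair_graph G" and sparse: "5 * card (parcs G) < 12 * card (pverts G)"
  shows "(\<exists>v \<in> pverts G. card (neighborhood G v) \<le> 1) \<or>
    (\<exists>u v. (u, v) \<in> parcs G \<and> card (neighborhood G u) = 2 \<and> card (neighborhood G v) = 2)"
proof (rule ccontr)
  assume not: "\<not> ?thesis"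
  interpret pair_graph G by fact
  let ?d = "\<lambda>v. card (neighborhood G v)"
  define B where "B = {v \<in> pverts G. ?d v = 2}"
  define C where "C = pverts G - B"
  have fin: "finite B" "finite C" using pair_finite_verts by (auto simp: B_def C_def)
  have finN: "finite (neighborhood G v)" for v
    using pair_finite_verts by (rule rev_finite_subset) (auto simp: neighborhood_def dest: in_arcsD2)
  have deg: "3 \<le> ?d v" if "v \<in> C" for v using that not by (force simp: B_def C_def)
  have BC: "v \<in> C" if "(u, v) \<in> parcs G" "u \<in> B" for u v
    using that not in_arcsD2 by (auto simp: B_def C_def)
  have split: "parcs G = Sigma B (neighborhood G) \<union> Sigma C (neighborhood G)"
    using in_arcsD1 by (auto simp: neighborhood_def C_def B_def)
  have cB: "card (Sigma B (neighborhood G)) = 2 * card B"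
    using fin finN by (simp add: card_SigmaI B_def)
  have cC: "card (Sigma C (neighborhood G)) = (\<Sum>v\<in>C. ?d v)" using fin finN by (simp add: card_SigmaI)
  have "card (parcs G) = card (Sigma B (neighborhood G)) + card (Sigma C (neighborhood G))"
    unfolding split using fin finN by (intro card_Un_disjoint) (auto simp: C_def)
  moreover have "3 * card C \<le> card (Sigma C (neighborhood G))"
    unfolding cC using sum_bounded_below[of C 3 ?d] deg by (simp add: mult.commute)
  \<comment> \<open>The discharging in counted form: reversing the arcs that leave \<open>B\<close>
    injects them into those leaving \<open>C\<close>. If \<open>s\<close> arcs leave
    \<open>C\<close>, then \<open>2 * card B\<close> and \<open>3 * card C\<close> are both at most
    \<open>s\<close>, so \<open>10 * card B + s + 4 * s\<close> is at least
    \<open>12 * card B + 12 * card C\<close>.\<close>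
  moreover have "card (Sigma B (neighborhood G)) \<le> card (Sigma C (neighborhood G))"
    using fin finN BC arcs_symmetric
    by (intro card_inj_on_le[of prod.swap]) (auto simp: neighborhood_def)
  moreover have "card (pverts G) = card B + card C"
    using card_Un_disjoint[of B C] fin by (auto simp: C_def B_def Un_absorb1 Un_Diff_cancel Int_Diff)
  ultimately show False using sparse cB by linarith
qed

text \<open>Induction on vertex subsets of one fixed graph, where each nonempty induced subgraph is
  sparse and so has a reducible configuration. For two adjacent vertices of degree 2, absence of
  triangles makes their other neighbours distinct.\<close>

lemma sparse_imp_choosable:
  assumes "pair_graph G"
    and sparse: "\<And>W. W \<subseteq> pverts G \<Longrightarrow> W \<noteq> {} \<Longrightarrow> 5 * card (parcs (induced G W)) < 12 * card W"
    and triangle: "\<And>u v w. (u, v) \<in> parcs G \<Longrightarrow> (v, w) \<in> parcs G \<Longrightarrow> (w, u) \<notin> parcs G"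
    and L: "\<And>v. v \<in> pverts G \<Longrightarrow> 5 \<le> card (L v)"
    and "W \<subseteq> pverts G"
  shows "\<exists>\<phi>. proper_conflict_free_coloring (induced G W) \<phi> \<and> (\<forall>v\<in>W. \<phi> v \<in> L v)"
  using assms(5)
proof (induction "card W" arbitrary: W rule: less_induct)
  case less
  interpret G: pair_graph G by fact
  interpret H: pair_graph "induced G W" by (rule pair_graph_induced) fact
  have WV: "pverts (induced G W) = W" using less.prems by auto
  have finW: "finite W" using less.prems G.pair_finite_verts finite_subset by blast
  have ind: "induced (induced G W) W' = induced G W'" if "W' \<subseteq> W" for W'
    using that less.prems by (auto simp: induced_def)
  show ?case
  proof (cases "W = {}")
    case True
    then show ?thesis by (auto simp: proper_conflict_free_coloring_def proper_coloring_def)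
  next
    case False
    then have "5 * card (parcs (induced G W)) < 12 * card (pverts (induced G W))"
      using sparse less.prems WV by simp
    from ex_reducible[OF pair_graph_induced[OF assms(1)] this] show ?thesis
    proof (elim disjE bexE exE conjE)
      fix v assume v: "v \<in> pverts (induced G W)" "card (neighborhood (induced G W) v) \<le> 1"
      then have "card (W - {v}) < card W" using finW WV by (intro psubset_card_mono) auto
      then obtain \<phi> where \<phi>: "proper_conflict_free_coloring (induced G (W - {v})) \<phi>" "\<forall>w\<in>W - {v}. \<phi> w \<in> L w"
        using less.hyps[of "W - {v}"] less.prems by blast
      interpret partial_coloring "induced G W" "W - {v}" \<phi>
        by unfold_locales (use \<phi>(1) ind less.prems in auto)
      have "3 \<le> card (L v)" using L[of v] v by simp
      then obtain c where "c \<in> L v" "proper_conflict_free_coloring (induced G W) (\<phi>(v := c))"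
        using extend_leaf[OF v(1) _ v(2), of "L v"] WV by auto
      then show ?thesis using \<phi>(2) by (intro exI[of _ "\<phi>(v := c)"]) auto
    next
      fix u v assume uv: "(u, v) \<in> parcs (induced G W)" "card (neighborhood (induced G W) u) = 2"
        "card (neighborhood (induced G W) v) = 2"
      let ?N = "neighborhood (induced G W)"
      have vu: "(v, u) \<in> parcs (induced G W)" using uv(1) by (rule H.arcs_symmetric)
      have "v \<in> ?N u" "u \<in> ?N v" using uv(1) vu by (auto simp: neighborhood_def)
      then obtain x y where N: "?N u = {x, v}" "x \<noteq> v" "?N v = {u, y}" "u \<noteq> y"
        using uv(2,3) by (metis card_2_iff doubleton_eq_iff insertE singletonD)
      then have "(u, x) \<in> parcs G" "(v, y) \<in> parcs G" "(u, v) \<in> parcs G"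
        using uv(1) by (auto simp: neighborhood_def)
      then have "x \<noteq> y" using triangle[of u v x] G.arcs_symmetric by blast
      have uvW: "u \<in> W" "v \<in> W" using uv(1) by auto
      then have "card (W - {u, v}) < card W" using finW by (intro psubset_card_mono) auto
      then obtain \<phi> where \<phi>: "proper_conflict_free_coloring (induced G (W - {u, v})) \<phi>" "\<forall>w\<in>W - {u, v}. \<phi> w \<in> L w"
        using less.hyps[of "W - {u, v}"] less.prems by blast
      interpret partial_coloring "induced G W" "W - {u, v}" \<phi>
        by unfold_locales (use \<phi>(1) ind less.prems in auto)
      have "5 \<le> card (L u)" "5 \<le> card (L v)" using L uvW less.prems by auto
      then obtain c d where "c \<in> L u" "d \<in> L v" "proper_conflict_free_coloring (induced G W) (\<phi>(u := c, v := d))"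
        using extend_adjacent_two_vertices[OF N(1,3) _ \<open>x \<noteq> y\<close> N(2,4), of "L u" "L v"] WV by auto
      then show ?thesis using \<phi>(2) H.no_loops'[OF uv(1)] by (intro exI[of _ "\<phi>(u := c, v := d)"]) auto
    qed
  qed
qed

section \<open>From edges and girth to arcs and vertex lists\<close>

lemma card_parcs_le:
  assumes "pair_graph G"
  shows "card (parcs G) \<le> 2 * card (uedges G)"
proof -
  interpret pair_graph G by fact
  define F where "F e = {(u, v). (u, v) \<in> parcs G \<and> {u, v} = e}" for e
  have "uedges G = (\<lambda>(u, v). {u, v}) ` parcs G" by (auto simp: uedges_def)
  then have fin: "finite (uedges G)" using pair_finite_arcs by simp
  have "card (F e) \<le> 2" if e: "e \<in> uedges G" for e
  proof -
    obtain u v where uv: "e = {u, v}" using e by (auto simp: uedges_def)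
    have "F e \<subseteq> {(u, v), (v, u)}" unfolding F_def uv doubleton_eq_iff by blast
    then have "card (F e) \<le> card {(u, v), (v, u)}" by (rule card_mono[rotated]) simp
    also have "card {x, y} \<le> 2" for x y :: "'a \<times> 'a" by (simp add: card_insert_if)
    finally show ?thesis .
  qed
  then have "(\<Sum>e\<in>uedges G. card (F e)) \<le> (\<Sum>e\<in>uedges G. 2)" by (rule sum_mono)
  moreover have "parcs G = (\<Union>e\<in>uedges G. F e)" by (auto simp: uedges_def F_def)
  ultimately show ?thesis using card_UN_le[OF fin, of F] by simp
qed

text \<open>Library cycles are lists of arcs, whereas \<open>gcycle\<close> uses vertices; this is
  the passage between them.\<close>

fun arcs_of :: "'a list \<Rightarrow> ('a \<times> 'a) list" where
  "arcs_of (u # v # xs) = (u, v) # arcs_of (v # xs)"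
| "arcs_of _ = []"

lemma length_arcs_of: "length (arcs_of xs) = length xs - 1"
  by (induction xs rule: arcs_of.induct) auto

lemma arcs_of_walk:
  "rwalk A xs \<Longrightarrow> xs \<noteq> [] \<Longrightarrow>
     pcas (hd xs) (arcs_of xs) (last xs) \<and> pawalk_verts (hd xs) (arcs_of xs) = xs \<and> set (arcs_of xs) \<subseteq> A"
  by (induction xs rule: arcs_of.induct) auto

text \<open>The closed walk has one more entry than \<open>xs\<close>, so it has exactly
  \<open>length xs\<close> arcs. These form a library cycle with at least three arcs, one of those
  over which the girth is the infimum.\<close>

lemma girth_le_length:
  assumes "pair_graph G" "gcycle (parcs G) xs"
  shows "girth G \<le> enat (length xs)"
proof -
  interpret pair_graph G by fact
  let ?ws = "xs @ [hd xs]"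
  have g: "distinct xs" "3 \<le> length xs" "rwalk (parcs G) ?ws" using assms(2) by (auto simp: gcycle_def)
  obtain x y ys where xs: "xs = x # y # ys" using g(2) by (cases xs rule: arcs_of.cases) auto
  have w: "pcas (hd ?ws) (arcs_of ?ws) (last ?ws)" "pawalk_verts (hd ?ws) (arcs_of ?ws) = ?ws"
    "set (arcs_of ?ws) \<subseteq> parcs G" using arcs_of_walk[OF g(3)] by auto
  have len: "length (arcs_of ?ws) = length xs" by (simp add: length_arcs_of)
  have "(x, y) \<in> parcs G" using g(3) by (simp add: xs)
  then have "x \<in> pverts G" by (rule in_arcsD1)
  then have "awalk x (arcs_of ?ws) x" using w by (auto simp: awalk_def xs)
  moreover have "distinct (tl (pawalk_verts x (arcs_of ?ws)))" using w(2) g(1) by (auto simp: xs)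
  ultimately have "cycle (arcs_of ?ws)" unfolding cycle_def using len g(2) by fastforce
  then have "girth G \<le> enat (length (arcs_of ?ws))"
    unfolding girth_def using len g(2) by (intro INF_lower) simp
  then show ?thesis by (simp only: len)
qed

theorem theorem5p1:
  fixes G :: "'a pair_pre_digraph"
  assumes "pair_graph G"
    and "planar G"
    and "12 \<le> girth G"
  shows "proper_conflict_free_choosable TYPE('c) 6 G"
  unfolding proper_conflict_free_choosable_def
proof (intro allI impI)
  fix L :: "'a \<Rightarrow> 'c set"
  assume L: "\<forall>v\<in>pverts G. finite (L v) \<and> card (L v) = 6"
  obtain p \<gamma> where dr: "plane_drawing G p \<gamma>" using assms(2) by (auto simp: planar_def)
  \<comment> \<open>The girth bound takes the form \<open>h + 2\<close> with \<open>h = 10\<close>,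
    as the edge bound requires.\<close>
  have long: "10 + 2 \<le> length xs" if "gcycle (parcs G) xs" for xs
    using order_trans[OF assms(3) girth_le_length[OF assms(1) that]]
    by (simp add: numeral_eq_enat)
  have sparse: "5 * card (parcs (induced G W)) < 12 * card W" if W: "W \<subseteq> pverts G" "W \<noteq> {}" for W
  proof -
    have pg: "pair_graph (induced G W)" using pair_graph_induced[OF assms(1)] .
    have "10 * card (uedges (induced G W)) + (10 + 2) \<le> (10 + 2) * card (pverts (induced G W))"
    proof (rule plane_graph_edge_bound[OF pg plane_drawing_induced[OF dr assms(1)]])
      show "pverts (induced G W) \<noteq> {}" using W by auto
      show "10 + 2 \<le> length xs" if "gcycle (parcs (induced G W)) xs" for xs
        using long gcycle_mono[OF that] by simp
    qed
    moreover have "pverts (induced G W) = W" using W by auto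
    \<comment> \<open>Each edge carries at most two arcs, so five times the arcs is at most ten
      times the edges; the constant 12 makes the inequality strict.\<close>
    ultimately show ?thesis using card_parcs_le[OF pg] by simp
  qed
  have triangle: "(w, u) \<notin> parcs G" if "(u, v) \<in> parcs G" "(v, w) \<in> parcs G" for u v w
  proof
    interpret pair_graph G by fact
    assume "(w, u) \<in> parcs G"
    then have "gcycle (parcs G) [u, v, w]" using that no_loops' by (auto simp: gcycle_def)
    then show False using long by fastforce
  qed
  have "induced G (pverts G) = G"
  proof -
    interpret pair_graph G by fact
    have "parcs G \<inter> pverts G \<times> pverts G = parcs G" using in_arcsD1 in_arcsD2 by auto
    then show ?thesis by (simp add: induced_def)
  qed
  then show "\<exists>\<phi>. proper_conflict_free_coloring G \<phi> \<and> (\<forall>v\<in>pverts G. \<phi> v \<in> L v)"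
    using sparse_imp_choosable[OF assms(1) sparse triangle, where L = L and W = "pverts G"] L by simp
qed

end
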